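(* Let $G$ be a graph, let $l$ be a nonincreasing intersecting supermodular nonnegative integer-valued function on subsets of $V(G)$, and let $\ell$ be a $2$-intersecting supermodular subadditive nonnegative integer-valued function on subsets of $V(G)$. Suppose $d_G(v)\ge 2\ell(v)+2l(v)$ for each vertex $v$, and for any two disjoint vertex sets $A,B$ with $A\cup B\subsetneq V(G)$ and $e_G(A\cup B)>\sum_{v\in A\cup B}\ell(v)-\ell(A\cup B)$, $$d_{G-B}(A)\ge 2\ell(A\cup B)-\sum_{v\in B}\ell(v)+\begin{cases}0,&\text{if }A=\emptyset;\\ 2l(A\cup B),&\text{if }A\neq\emptyset.\end{cases}$$ Then for every edge set $M\subseteq E(G)$ with $|M|\le l(V(G))+\ell(V(G))$, the edge set of $G$ can be decomposed into $M$, the edge set of a spanning $l$-partition-connected subgraph, and the edge set of a spanning $\ell$-rigid subgraph (these three being pairwise disjoint).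
   Context: Graphs are finite, loopless, multiple edges allowed. $d_{G-B}(A)$ is the number of edges of $G-B$ with exactly one end in $A$; $e_H(X)$ the number of edges of $H$ with both ends in $X$; $e_H(P)$ the number of edges joining different parts of a partition $P$. Set functions are zero on $\emptyset$, $f(v)=f(\{v\})$. $f$ is $c$-intersecting supermodular if $f(A\cap B)+f(A\cup B)\ge f(A)+f(B)$ whenever $|A\cap B|\ge c$ (intersecting: $c=1$); subadditive if $f(A)+f(B)\ge f(A\cup B)$ for disjoint $A,B$; nonincreasing if $f(A)\ge f(B)$ for nonempty $A\subseteq B$. A graph $H$ is $f$-partition-connected if $e_H(P)\ge\sum_{X\in P}f(X)-f(V(H))$ for all partitions $P$ of $V(H)$, and $f$-rigid if it has a spanning subgraph $F$ with $e_F(X)\le\sum_{v\in X}f(v)-f(X)$ for all $X$ and $|E(F)|=\sum_{v\in V(H)}f(v)-f(V(H))$. *)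

theory Defs
  imports Main "HOL-Library.Disjoint_Sets"
begin

text \<open>
  Edges carry identities, so parallel edges are distinct elements of \<open>medges\<close>
  with the same set of ends; a two-element set of ends excludes loops.
\<close>

record ('v, 'e) multigraph =
  mverts :: "'v set"
  medges :: "'e set"
  mends  :: "'e \<Rightarrow> 'v set"

definition finite_multigraph :: "('v, 'e) multigraph \<Rightarrow> bool" where
  "finite_multigraph G \<longleftrightarrow>
     finite (mverts G) \<and> finite (medges G) \<and>
     (\<forall>e\<in>medges G. mends G e \<subseteq> mverts G \<and> card (mends G e) = 2)"

definition spanning_subgraph :: "('v, 'e) multigraph \<Rightarrow> ('v, 'e) multigraph \<Rightarrow> bool" where
  "spanning_subgraph H G \<longleftrightarrow>
     mverts H = mverts G \<and> medges H \<subseteq> medges G \<and>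
     (\<forall>e\<in>medges H. mends H e = mends G e)"

definition delete_verts :: "('v, 'e) multigraph \<Rightarrow> 'v set \<Rightarrow> ('v, 'e) multigraph" where
  "delete_verts G B =
     \<lparr>mverts = mverts G - B, medges = {e \<in> medges G. mends G e \<inter> B = {}}, mends = mends G\<rparr>"

definition vertex_degree :: "('v, 'e) multigraph \<Rightarrow> 'v \<Rightarrow> nat" where
  "vertex_degree G v = card {e \<in> medges G. v \<in> mends G e}"

definition cut_degree :: "('v, 'e) multigraph \<Rightarrow> 'v set \<Rightarrow> nat" where
  "cut_degree G A = card {e \<in> medges G. card (mends G e \<inter> A) = 1}"

definition induced_edge_count :: "('v, 'e) multigraph \<Rightarrow> 'v set \<Rightarrow> nat" where
  "induced_edge_count G X = card {e \<in> medges G. mends G e \<subseteq> X}"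

definition cross_edge_count :: "('v, 'e) multigraph \<Rightarrow> 'v set set \<Rightarrow> nat" where
  "cross_edge_count G P =
     card {e \<in> medges G. \<exists>X\<in>P. \<exists>Y\<in>P. X \<noteq> Y \<and> mends G e \<inter> X \<noteq> {} \<and> mends G e \<inter> Y \<noteq> {}}"

text \<open>
  The values of a set function on sets not contained in the ground set \<open>V\<close> are irrelevant.
\<close>

definition intersecting_supermodular_on :: "nat \<Rightarrow> 'v set \<Rightarrow> ('v set \<Rightarrow> int) \<Rightarrow> bool" where
  "intersecting_supermodular_on c V f \<longleftrightarrow>
     (\<forall>A B. A \<subseteq> V \<longrightarrow> B \<subseteq> V \<longrightarrow> c \<le> card (A \<inter> B) \<longrightarrow>
        f (A \<inter> B) + f (A \<union> B) \<ge> f A + f B)"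

definition subadditive_on :: "'v set \<Rightarrow> ('v set \<Rightarrow> int) \<Rightarrow> bool" where
  "subadditive_on V f \<longleftrightarrow>
     (\<forall>A B. A \<subseteq> V \<longrightarrow> B \<subseteq> V \<longrightarrow> A \<inter> B = {} \<longrightarrow> f A + f B \<ge> f (A \<union> B))"

definition nonincreasing_on :: "'v set \<Rightarrow> ('v set \<Rightarrow> int) \<Rightarrow> bool" where
  "nonincreasing_on V f \<longleftrightarrow>
     (\<forall>A B. A \<noteq> {} \<longrightarrow> A \<subseteq> B \<longrightarrow> B \<subseteq> V \<longrightarrow> f A \<ge> f B)"

definition nonnegative_set_function_on :: "'v set \<Rightarrow> ('v set \<Rightarrow> int) \<Rightarrow> bool" where
  "nonnegative_set_function_on V f \<longleftrightarrow> f {} = 0 \<and> (\<forall>A. A \<subseteq> V \<longrightarrow> f A \<ge> 0)"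

definition partition_connected :: "('v set \<Rightarrow> int) \<Rightarrow> ('v, 'e) multigraph \<Rightarrow> bool" where
  "partition_connected f H \<longleftrightarrow>
     (\<forall>P. partition_on (mverts H) P \<longrightarrow>
        int (cross_edge_count H P) \<ge> (\<Sum>X\<in>P. f X) - f (mverts H))"

definition rigid :: "('v set \<Rightarrow> int) \<Rightarrow> ('v, 'e) multigraph \<Rightarrow> bool" where
  "rigid f H \<longleftrightarrow>
     (\<exists>F. spanning_subgraph F H \<and>
        (\<forall>X. X \<subseteq> mverts H \<longrightarrow> int (induced_edge_count F X) \<le> (\<Sum>v\<in>X. f {v}) - f X) \<and>
        int (card (medges F)) = (\<Sum>v\<in>mverts H. f {v}) - f (mverts H))"

end

theory Submission
  imports Defs
begin

text \<open>
  For a set function \<open>f\<close> put \<open>slack f X = (\<Sum>v\<in>X. f {v}) - f X\<close>. The edge sets with at most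
  \<open>slack f X\<close> edges inside every \<open>X\<close> are the independent sets of a matroid, both for \<open>f = l\<close> and
  for \<open>f = ell\<close>. A set \<open>I1\<close> of size \<open>slack l V\<close> independent for \<open>l\<close> is \<open>l\<close>-partition-connected,
  and a set \<open>I2\<close> of size \<open>slack ell V\<close> independent for \<open>ell\<close> is \<open>ell\<close>-rigid. So it suffices to find
  disjoint \<open>I1\<close>, \<open>I2\<close> of these sizes outside \<open>M\<close> and to add all remaining edges to \<open>I2\<close>.

  By matroid union this amounts to a rank inequality. The rank of an edge set \<open>K\<close> is the number of
  edges of \<open>K\<close> lying in no member of a suitable family plus the total slack of the family. This family
  is a partition \<open>P\<close> for \<open>l\<close>, and for \<open>ell\<close> a family \<open>Q\<close> whose members meet pairwise in at most one
  vertex. Subadditivity of \<open>ell\<close> allows replacing \<open>Q\<close> by its common refinement with \<open>P\<close>, and members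
  spanning no more edges than their slack may be dropped. What remains is a double count, part by part,
  of the uncovered edges by their ends: vertices in no member contribute their degree, and a member \<open>Y\<close>
  contributes the cut condition with \<open>B\<close> the vertices of \<open>Y\<close> shared with other members and \<open>A = Y - B\<close>.
  If every vertex of a part \<open>X\<close> is shared, the condition with \<open>A = {}\<close> for each member makes \<open>X\<close>
  itself dense, so that the cut condition applies to \<open>X\<close>.
\<close>

section \<open>Union of two matroids\<close>

text \<open>Bounding only singletons by 1 suffices: submodularity then gives
  \<open>r A \<le> card A\<close>, and monotonicity gives nonnegativity. Values are integers so that
  a contraction can subtract 1.\<close>

definition matroid_rank :: "'e set \<Rightarrow> ('e set \<Rightarrow> int) \<Rightarrow> bool" where
  "matroid_rank E r \<longleftrightarrow>
     r {} = 0 \<and> (\<forall>A B. A \<subseteq> B \<longrightarrow> B \<subseteq> E \<longrightarrow> r A \<le> r B) \<and> (\<forall>e\<in>E. r {e} \<le> 1) \<and>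
     (\<forall>A B. A \<subseteq> E \<longrightarrow> B \<subseteq> E \<longrightarrow> r (A \<inter> B) + r (A \<union> B) \<le> r A + r B)"

lemma matroid_rankD:
  assumes "matroid_rank E r"
  shows "r {} = 0" "\<And>A B. A \<subseteq> B \<Longrightarrow> B \<subseteq> E \<Longrightarrow> r A \<le> r B" "\<And>e. e \<in> E \<Longrightarrow> r {e} \<le> 1"
    "\<And>A B. A \<subseteq> E \<Longrightarrow> B \<subseteq> E \<Longrightarrow> r (A \<inter> B) + r (A \<union> B) \<le> r A + r B"
  using assms unfolding matroid_rank_def by blast+

lemma matroid_rank_subset: "matroid_rank E r \<Longrightarrow> E' \<subseteq> E \<Longrightarrow> matroid_rank E' r"
  unfolding matroid_rank_def by (meson subset_iff)

text \<open>This is the rank function of the matroid contracted by the non-loop \<open>e\<close>;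
  subtracting \<open>r {e} = 1\<close> restores the value 0 at the empty set.\<close>

lemma matroid_rank_contract:
  assumes r: "matroid_rank (insert e E) r" and e: "r {e} = 1"
  shows "matroid_rank E (\<lambda>K. r (insert e K) - 1)"
  unfolding matroid_rank_def
proof (intro conjI allI impI ballI)
  show "r (insert e {}) - 1 = 0" using e by simp
next
  fix A B assume "A \<subseteq> B" "B \<subseteq> E"
  then have "r (insert e A) \<le> r (insert e B)" by (intro matroid_rankD(2)[OF r]) auto
  then show "r (insert e A) - 1 \<le> r (insert e B) - 1" by simp
next
  fix f assume f: "f \<in> E"
  show "r (insert e {f}) - 1 \<le> 1"
  proof (cases "f = e")
    case True then show ?thesis using e by simp
  next
    case False
    have "r ({e} \<inter> {f}) + r ({e} \<union> {f}) \<le> r {e} + r {f}"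
      using f by (intro matroid_rankD(4)[OF r]) auto
    moreover have "r {f} \<le> 1" using matroid_rankD(3)[OF r] f by blast
    ultimately show ?thesis using False e matroid_rankD(1)[OF r] by (simp add: insert_commute)
  qed
next
  fix A B assume AB: "A \<subseteq> E" "B \<subseteq> E"
  have "r (insert e A \<inter> insert e B) + r (insert e A \<union> insert e B) \<le> r (insert e A) + r (insert e B)"
    using AB by (intro matroid_rankD(4)[OF r]) auto
  moreover have "insert e A \<inter> insert e B = insert e (A \<inter> B)" "insert e A \<union> insert e B = insert e (A \<union> B)"
    by auto
  ultimately show "r (insert e (A \<inter> B)) - 1 + (r (insert e (A \<union> B)) - 1) \<le> r (insert e A) - 1 + (r (insert e B) - 1)"
    by simp
qed

text \<open>The hard half of the matroid union formula, with \<open>k\<close> in place of the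
  maximum and independence written as rank equal to cardinality. In the induction, \<open>e\<close>
  is contracted in one matroid and deleted from the other while \<open>k\<close> drops by 1, or it
  is discarded as a loop of both.\<close>

theorem matroid_union_two:
  assumes "finite E" "matroid_rank E r1" "matroid_rank E r2"
    and "\<And>K. K \<subseteq> E \<Longrightarrow> k \<le> int (card (E - K)) + r1 K + r2 K"
  shows "\<exists>I1 I2. I1 \<subseteq> E \<and> I2 \<subseteq> E \<and> I1 \<inter> I2 = {} \<and> r1 I1 = int (card I1) \<and> r2 I2 = int (card I2) \<and>
           k \<le> int (card I1) + int (card I2)"
  using assms
proof (induction E arbitrary: r1 r2 k rule: finite_induct)
  case empty
  then show ?case using matroid_rankD(1)[OF empty(1)] matroid_rankD(1)[OF empty(2)] empty(3)[of "{}"]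
    by auto
next
  case (insert e E)
  note r1 = insert.prems(1) and r2 = insert.prems(2) and k = insert.prems(3)
  have sub: "matroid_rank E r1" "matroid_rank E r2"
    using r1 r2 matroid_rank_subset by blast+
  have val: "r {e} = 0 \<or> r {e} = 1" if "matroid_rank (insert e E) r" for r
  proof -
    have "r {} \<le> r {e}" by (rule matroid_rankD(2)[OF that]) auto
    then show ?thesis using matroid_rankD(1)[OF that] matroid_rankD(3)[OF that, of e] by auto
  qed
  have loop: "r (insert e K) \<le> r K" if "matroid_rank (insert e E) r" "r {e} = 0" "K \<subseteq> E" for r K
  proof -
    have "r ({e} \<inter> K) + r ({e} \<union> K) \<le> r {e} + r K" using that(3) by (intro matroid_rankD(4)[OF that(1)]) auto
    moreover have "{e} \<inter> K = {}" using that(3) insert(2) by auto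
    ultimately show ?thesis using that matroid_rankD(1)[OF that(1)] by simp
  qed
  have cardE: "int (card (insert e E - K)) = int (card (E - K)) + 1" if "K \<subseteq> E" for K
  proof -
    have "insert e E - K = insert e (E - K)" using that insert(2) by auto
    then show ?thesis using insert(1,2) by simp
  qed
  have cardE': "insert e E - insert e K = E - K" for K using insert(2) by auto
  \<comment> \<open>Put \<open>e\<close> into \<open>I1\<close> or into \<open>I2\<close>; if neither keeps the rank condition, the two violating sets uncross.\<close>
  show ?case
  proof (cases "r1 {e} = 1 \<and> (\<forall>K. K \<subseteq> E \<longrightarrow> k \<le> int (card (E - K)) + r1 (insert e K) + r2 K)")
    case True
    have "\<exists>I1 I2. I1 \<subseteq> E \<and> I2 \<subseteq> E \<and> I1 \<inter> I2 = {} \<and> r1 (insert e I1) - 1 = int (card I1) \<and>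
           r2 I2 = int (card I2) \<and> k - 1 \<le> int (card I1) + int (card I2)"
    proof (rule insert.IH[OF _ sub(2)])
      show "matroid_rank E (\<lambda>K. r1 (insert e K) - 1)" using matroid_rank_contract[OF r1] True by blast
    next
      fix K assume "K \<subseteq> E"
      then have "k \<le> int (card (E - K)) + r1 (insert e K) + r2 K" using True by blast
      then show "k - 1 \<le> int (card (E - K)) + (r1 (insert e K) - 1) + r2 K" by linarith
    qed
    then obtain I1 I2 where I: "I1 \<subseteq> E" "I2 \<subseteq> E" "I1 \<inter> I2 = {}" "r1 (insert e I1) - 1 = int (card I1)"
           "r2 I2 = int (card I2)" "k - 1 \<le> int (card I1) + int (card I2)" by blast
    have "card (insert e I1) = Suc (card I1)"
      using I(1) insert(1,2) by (meson card_insert_disjoint finite_subset subsetD)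
    then show ?thesis using I insert(2)
      by (intro exI[of _ "insert e I1"] exI[of _ I2]) auto
  next
    case F1: False
    show ?thesis
    proof (cases "r2 {e} = 1 \<and> (\<forall>K. K \<subseteq> E \<longrightarrow> k \<le> int (card (E - K)) + r1 K + r2 (insert e K))")
      case True
      have "\<exists>I1 I2. I1 \<subseteq> E \<and> I2 \<subseteq> E \<and> I1 \<inter> I2 = {} \<and> r1 I1 = int (card I1) \<and>
             r2 (insert e I2) - 1 = int (card I2) \<and> k - 1 \<le> int (card I1) + int (card I2)"
      proof (rule insert.IH[OF sub(1)])
        show "matroid_rank E (\<lambda>K. r2 (insert e K) - 1)" using matroid_rank_contract[OF r2] True by blast
      next
        fix K assume "K \<subseteq> E"
        then have "k \<le> int (card (E - K)) + r1 K + r2 (insert e K)" using True by blast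
        then show "k - 1 \<le> int (card (E - K)) + r1 K + (r2 (insert e K) - 1)" by linarith
      qed
      then obtain I1 I2 where I: "I1 \<subseteq> E" "I2 \<subseteq> E" "I1 \<inter> I2 = {}" "r2 (insert e I2) - 1 = int (card I2)"
             "r1 I1 = int (card I1)" "k - 1 \<le> int (card I1) + int (card I2)" by blast
      have "card (insert e I2) = Suc (card I2)"
        using I(2) insert(1,2) by (meson card_insert_disjoint finite_subset subsetD)
      then show ?thesis using I insert(2)
        by (intro exI[of _ I1] exI[of _ "insert e I2"]) auto
    next
      case F2: False
      \<comment> \<open>Adding the loop \<open>e\<close> to a violating set \<open>L\<close> does
        not raise \<open>r1\<close>, so \<open>insert e L\<close> would violate the hypothesis
        \<open>k\<close>. The next claim is symmetric.\<close>
      have z1: "r2 {e} = 0" if "r1 {e} = 0"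
      proof (rule ccontr)
        assume "r2 {e} \<noteq> 0"
        then obtain L where L: "L \<subseteq> E" "int (card (E - L)) + r1 L + r2 (insert e L) < k"
          using F2 val[OF r2] by (auto simp: not_le)
        moreover have "r1 (insert e L) \<le> r1 L" using loop[OF r1 that L(1)] .
        moreover have "k \<le> int (card (insert e E - insert e L)) + r1 (insert e L) + r2 (insert e L)"
          using L(1) by (intro k) auto
        ultimately show False unfolding cardE' by simp
      qed
      have z2: "r1 {e} = 0" if "r2 {e} = 0"
      proof (rule ccontr)
        assume "r1 {e} \<noteq> 0"
        then obtain L where L: "L \<subseteq> E" "int (card (E - L)) + r1 (insert e L) + r2 L < k"
          using F1 val[OF r1] by (auto simp: not_le)
        moreover have "r2 (insert e L) \<le> r2 L" using loop[OF r2 that L(1)] .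
        moreover have "k \<le> int (card (insert e E - insert e L)) + r1 (insert e L) + r2 (insert e L)"
          using L(1) by (intro k) auto
        ultimately show False unfolding cardE' by simp
      qed
      \<comment> \<open>The two violations add up to at most \<open>2 * k - 2\<close>. Submodularity
        bounds the same sum from below by the values at \<open>insert e (K \<union> L)\<close> and
        \<open>K \<inter> L\<close>; only the second complement contains \<open>e\<close>, so this
        lower bound is \<open>2 * k - 1\<close>.\<close>
      have zero: "r1 {e} = 0 \<and> r2 {e} = 0"
      proof (rule ccontr)
        assume "\<not> (r1 {e} = 0 \<and> r2 {e} = 0)"
        then have "r1 {e} = 1" "r2 {e} = 1" using z1 z2 val[OF r1] val[OF r2] by auto
        then obtain K L where KL: "K \<subseteq> E" "int (card (E - K)) + r1 (insert e K) + r2 K < k"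
          "L \<subseteq> E" "int (card (E - L)) + r1 L + r2 (insert e L) < k" using F1 F2 by (auto simp: not_le)
        have eq: "insert e K \<inter> L = K \<inter> L" "insert e K \<union> L = insert e (K \<union> L)"
            "K \<inter> insert e L = K \<inter> L" "K \<union> insert e L = insert e (K \<union> L)"
          using KL(1,3) insert(2) by auto
        have "r1 (insert e K \<inter> L) + r1 (insert e K \<union> L) \<le> r1 (insert e K) + r1 L"
          using KL by (intro matroid_rankD(4)[OF r1]) auto
        moreover have "r2 (K \<inter> insert e L) + r2 (K \<union> insert e L) \<le> r2 K + r2 (insert e L)"
          using KL by (intro matroid_rankD(4)[OF r2]) auto
        moreover have "int (card (E - K)) + int (card (E - L)) = int (card (E - (K \<union> L))) + int (card (E - (K \<inter> L)))"
          using card_Un_Int[of "E - K" "E - L"] insert(1) by (simp add: Diff_Un Diff_Int)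
        moreover have "k \<le> int (card (insert e E - insert e (K \<union> L))) + r1 (insert e (K \<union> L)) + r2 (insert e (K \<union> L))"
          using KL by (intro k) auto
        moreover have "k \<le> int (card (insert e E - (K \<inter> L))) + r1 (K \<inter> L) + r2 (K \<inter> L)"
          using KL by (intro k) auto
        moreover have "int (card (insert e E - (K \<inter> L))) = int (card (E - (K \<inter> L))) + 1"
          using KL by (intro cardE) auto
        ultimately show False using KL(2,4) unfolding cardE' eq by linarith
      qed
      have "\<exists>I1 I2. I1 \<subseteq> E \<and> I2 \<subseteq> E \<and> I1 \<inter> I2 = {} \<and> r1 I1 = int (card I1) \<and> r2 I2 = int (card I2) \<and>
           k \<le> int (card I1) + int (card I2)"
      proof (rule insert.IH[OF sub])
        fix K assume K: "K \<subseteq> E"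
        have "k \<le> int (card (insert e E - insert e K)) + r1 (insert e K) + r2 (insert e K)"
          using K by (intro k) auto
        then show "k \<le> int (card (E - K)) + r1 K + r2 K"
          using loop[OF r1 _ K] loop[OF r2 _ K] zero unfolding cardE' by simp
      qed
      then show ?thesis by (meson subset_insertI2)
    qed
  qed
qed

section \<open>Rank functions from independence systems\<close>

definition max_card :: "('e set \<Rightarrow> bool) \<Rightarrow> 'e set \<Rightarrow> int" where
  "max_card indep K = int (Max (card ` {F. F \<subseteq> K \<and> indep F}))"

definition maximal_in :: "('e set \<Rightarrow> bool) \<Rightarrow> 'e set \<Rightarrow> 'e set \<Rightarrow> bool" where
  "maximal_in indep K F \<longleftrightarrow> F \<subseteq> K \<and> indep F \<and> (\<forall>e\<in>K - F. \<not> indep (insert e F))"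

lemma card_le_max_card:
  assumes "finite K" "F \<subseteq> K" "indep F"
  shows "int (card F) \<le> max_card indep K"
  unfolding max_card_def using assms by (auto intro!: Max_ge)

lemma max_card_attained:
  assumes "finite K" "indep {}"
  obtains F where "F \<subseteq> K" "indep F" "max_card indep K = int (card F)"
proof -
  have "Max (card ` {F. F \<subseteq> K \<and> indep F}) \<in> card ` {F. F \<subseteq> K \<and> indep F}"
    using assms by (intro Max_in) auto
  then show ?thesis using that unfolding max_card_def by auto
qed

lemma extend_to_maximal_in:
  assumes "finite K" "F \<subseteq> K" "indep F"
  obtains F' where "F \<subseteq> F'" "maximal_in indep K F'"
proof -
  have "\<exists>F'. F \<subseteq> F' \<and> maximal_in indep K F'"
    using assms(2,3)
  proof (induction "card (K - F)" arbitrary: F rule: less_induct)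
    case less
    show ?case
    proof (cases "maximal_in indep K F")
      case False
      then obtain e where e: "e \<in> K - F" "indep (insert e F)"
        using less.prems unfolding maximal_in_def by blast
      have "K - insert e F \<subset> K - F" using e by auto
      then have "card (K - insert e F) < card (K - F)" using assms(1) by (intro psubset_card_mono) auto
      then show ?thesis using less.hyps[of "insert e F"] e less.prems by auto
    qed auto
  qed
  then show ?thesis using that by metis
qed

lemma max_card_indep_iff:
  assumes "finite K" "indep {}"
  shows "max_card indep K = int (card K) \<longleftrightarrow> indep K"
proof
  assume eq: "max_card indep K = int (card K)"
  obtain F where "F \<subseteq> K" "indep F" "max_card indep K = int (card F)"
    by (rule max_card_attained[of K indep, OF assms])
  moreover from this have "F = K" using eq assms(1) by (intro card_subset_eq) auto
  ultimately show "indep K" by simp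
next
  assume K: "indep K"
  obtain F where "F \<subseteq> K" "indep F" "max_card indep K = int (card F)"
    by (rule max_card_attained[of K indep, OF assms])
  then show "max_card indep K = int (card K)"
    using card_le_max_card[of K K indep] K assms card_mono[of K F] by simp
qed

text \<open>The matroid axiom enters as \<open>maxi\<close>: maximal independent subsets of any
  \<open>K\<close> have maximum size. For submodularity, a largest independent subset of
  \<open>A \<inter> B\<close> is extended to a maximal one of \<open>A \<union> B\<close>, whose
  traces on \<open>A\<close> and \<open>B\<close> are independent.\<close>

lemma matroid_rank_max_card:
  assumes fin: "finite E" and emp: "indep {}"
    and down: "\<And>F F'. indep F \<Longrightarrow> F' \<subseteq> F \<Longrightarrow> indep F'"
    and maxi: "\<And>K F. K \<subseteq> E \<Longrightarrow> maximal_in indep K F \<Longrightarrow> max_card indep K \<le> int (card F)"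
  shows "matroid_rank E (max_card indep)"
  unfolding matroid_rank_def
proof (intro conjI allI impI ballI)
  show "max_card indep {} = 0" using max_card_indep_iff[of "{}" indep] emp by simp
next
  fix A B assume AB: "A \<subseteq> B" "B \<subseteq> E"
  then have f: "finite A" "finite B" using fin by (meson finite_subset)+
  obtain F where "F \<subseteq> A" "indep F" "max_card indep A = int (card F)"
    by (rule max_card_attained[of A indep, OF f(1) emp])
  then show "max_card indep A \<le> max_card indep B"
    using card_le_max_card[of B F indep] f AB by auto
next
  fix e assume "e \<in> E"
  obtain F where "F \<subseteq> {e}" "max_card indep {e} = int (card F)"
    by (rule max_card_attained[of "{e}" indep, OF _ emp]) auto
  then show "max_card indep {e} \<le> 1" using card_mono[of "{e}" F] by simp
next
  fix A B assume AB: "A \<subseteq> E" "B \<subseteq> E"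
  then have f: "finite A" "finite B" using fin by (meson finite_subset)+
  obtain F where F: "F \<subseteq> A \<inter> B" "indep F" "max_card indep (A \<inter> B) = int (card F)"
    by (rule max_card_attained[of "A \<inter> B" indep, OF _ emp]) (use f in auto)
  obtain F' where F': "F \<subseteq> F'" "maximal_in indep (A \<union> B) F'"
    by (rule extend_to_maximal_in[of "A \<union> B" F indep]) (use F f in auto)
  have sub: "F' \<subseteq> A \<union> B" "indep F'" using F'(2) unfolding maximal_in_def by auto
  have fF': "finite F'" using sub f finite_subset by blast
  have "max_card indep (A \<union> B) \<le> int (card F')" using maxi[OF _ F'(2)] AB by auto
  moreover have "int (card (F' \<inter> A)) \<le> max_card indep A" "int (card (F' \<inter> B)) \<le> max_card indep B"
    using f sub down by (auto intro!: card_le_max_card)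
  moreover have "card (F' \<inter> A) + card (F' \<inter> B) = card F' + card (F' \<inter> A \<inter> B)"
  proof -
    have "(F' \<inter> A) \<union> (F' \<inter> B) = F'" "(F' \<inter> A) \<inter> (F' \<inter> B) = F' \<inter> A \<inter> B" using sub by auto
    then show ?thesis using card_Un_Int[of "F' \<inter> A" "F' \<inter> B"] fF' by simp
  qed
  moreover have "card F \<le> card (F' \<inter> A \<inter> B)" using F F' fF' by (intro card_mono) auto
  ultimately show "max_card indep (A \<inter> B) + max_card indep (A \<union> B) \<le> max_card indep A + max_card indep B"
    using F(3) by linarith
qed

section \<open>Sparse edge sets\<close>

definition edges_in :: "('e \<Rightarrow> 'v set) \<Rightarrow> 'e set \<Rightarrow> 'v set \<Rightarrow> 'e set" where
  "edges_in N F X = {e \<in> F. N e \<subseteq> X}"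

text \<open>For a partition these are the edges joining different parts.\<close>

definition uncovered :: "('e \<Rightarrow> 'v set) \<Rightarrow> 'e set \<Rightarrow> 'v set set \<Rightarrow> 'e set" where
  "uncovered N F Q = {e \<in> F. \<forall>Y\<in>Q. \<not> N e \<subseteq> Y}"

text \<open>Finiteness is required explicitly because \<open>card\<close> is 0 on infinite
  sets.\<close>

definition sparse :: "'v set \<Rightarrow> ('e \<Rightarrow> 'v set) \<Rightarrow> ('v set \<Rightarrow> int) \<Rightarrow> 'e set \<Rightarrow> bool" where
  "sparse V N b F \<longleftrightarrow> finite F \<and> (\<forall>X\<subseteq>V. int (card (edges_in N F X)) \<le> b X)"

definition intersecting_submodular_on :: "nat \<Rightarrow> 'v set \<Rightarrow> ('v set \<Rightarrow> int) \<Rightarrow> bool" where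
  "intersecting_submodular_on c V b \<longleftrightarrow>
     (\<forall>A B. A \<subseteq> V \<longrightarrow> B \<subseteq> V \<longrightarrow> c \<le> card (A \<inter> B) \<longrightarrow> b (A \<inter> B) + b (A \<union> B) \<le> b A + b B)"

lemma finite_edges_in [simp]: "finite F \<Longrightarrow> finite (edges_in N F X)"
  unfolding edges_in_def by simp

lemma finite_uncovered [simp]: "finite F \<Longrightarrow> finite (uncovered N F Q)"
  unfolding uncovered_def by simp

lemma sparse_mono: "sparse V N b F \<Longrightarrow> F' \<subseteq> F \<Longrightarrow> sparse V N b F'"
proof -
  assume s: "sparse V N b F" and sub: "F' \<subseteq> F"
  have fin: "finite F" using s unfolding sparse_def by simp
  have "int (card (edges_in N F' X)) \<le> b X" if "X \<subseteq> V" for X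
  proof -
    have "card (edges_in N F' X) \<le> card (edges_in N F X)"
      using fin sub by (intro card_mono) (auto simp: edges_in_def)
    moreover have "int (card (edges_in N F X)) \<le> b X" using s that unfolding sparse_def by simp
    ultimately show ?thesis by linarith
  qed
  then show ?thesis using fin sub finite_subset unfolding sparse_def by simp
qed

section \<open>The matroid of sparse edge sets and its rank formula\<close>

locale edge_set =
  fixes V :: "'v set" and E :: "'e set" and N :: "'e \<Rightarrow> 'v set"
  assumes finite_V: "finite V" and finite_E: "finite E"
    and ends: "\<And>e. e \<in> E \<Longrightarrow> N e \<subseteq> V" "\<And>e. e \<in> E \<Longrightarrow> card (N e) = 2"
begin

lemma finite_sub: "F \<subseteq> E \<Longrightarrow> finite F" "X \<subseteq> V \<Longrightarrow> finite X"
  using finite_E finite_V by (simp_all add: finite_subset)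

lemma finite_family: "Q \<subseteq> Pow V \<Longrightarrow> finite Q"
  using finite_V by (simp add: finite_subset)

text \<open>Two members share at most one vertex, while an edge has two ends, so no edge lies inside
  two members.\<close>

lemma card_edge_decomposition:
  assumes F: "F \<subseteq> E" and Q: "Q \<subseteq> Pow V"
    and dis: "pairwise (\<lambda>Y Z. card (Y \<inter> Z) < 2) Q"
  shows "card F = card (uncovered N F Q) + (\<Sum>Y\<in>Q. card (edges_in N F Y))"
proof -
  have fin: "finite F" "finite Q" using F Q finite_sub finite_family by auto
  have "edges_in N F Y \<inter> edges_in N F Z = {}" if YZ: "Y \<in> Q" "Z \<in> Q" "Y \<noteq> Z" for Y Z
  proof (rule ccontr)
    assume "edges_in N F Y \<inter> edges_in N F Z \<noteq> {}"
    then obtain e where e: "e \<in> F" "N e \<subseteq> Y \<inter> Z" unfolding edges_in_def by auto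
    have "finite (Y \<inter> Z)" using YZ Q finite_sub by auto
    then have "card (N e) \<le> card (Y \<inter> Z)" using e by (intro card_mono)
    then show False using ends(2)[of e] e F pairwiseD[OF dis YZ] by auto
  qed
  then have "card (\<Union>Y\<in>Q. edges_in N F Y) = (\<Sum>Y\<in>Q. card (edges_in N F Y))"
    using fin by (intro card_UN_disjoint) auto
  moreover have "F = uncovered N F Q \<union> (\<Union>Y\<in>Q. edges_in N F Y)"
    unfolding uncovered_def edges_in_def by auto
  moreover have "card (uncovered N F Q \<union> (\<Union>Y\<in>Q. edges_in N F Y)) =
      card (uncovered N F Q) + card (\<Union>Y\<in>Q. edges_in N F Y)"
    using fin by (intro card_Un_disjoint) (auto simp: uncovered_def edges_in_def)
  ultimately show ?thesis by simp
qed

lemma card_edges_in_supermodular: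
  assumes "F \<subseteq> E"
  shows "card (edges_in N F X) + card (edges_in N F Y) \<le>
           card (edges_in N F (X \<inter> Y)) + card (edges_in N F (X \<union> Y))"
proof -
  have f: "finite F" using assms finite_sub by simp
  have "card (edges_in N F X \<union> edges_in N F Y) \<le> card (edges_in N F (X \<union> Y))"
    using f by (intro card_mono) (auto simp: edges_in_def)
  moreover have "edges_in N F X \<inter> edges_in N F Y = edges_in N F (X \<inter> Y)"
    by (auto simp: edges_in_def)
  ultimately show ?thesis using card_Un_Int[of "edges_in N F X" "edges_in N F Y"] f by simp
qed

text \<open>Every edge of \<open>K\<close> rejected by \<open>F\<close> lies inside a set that is
  tight for \<open>F\<close>. Hence the maximal tight sets cover \<open>K - F\<close>, and each
  contains exactly \<open>b Y\<close> edges of \<open>F\<close>.\<close>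

lemma maximal_sparse_card:
  assumes c: "c \<le> 2" and sub: "intersecting_submodular_on c V b"
    and K: "K \<subseteq> E" and F: "maximal_in (sparse V N b) K F"
  obtains Q where "Q \<subseteq> Pow V" "pairwise (\<lambda>Y Z. card (Y \<inter> Z) < c) Q"
    "int (card F) = int (card (uncovered N K Q)) + (\<Sum>Y\<in>Q. b Y)"
proof -
  have FK: "F \<subseteq> K" and sF: "sparse V N b F" and mx: "\<And>e. e \<in> K - F \<Longrightarrow> \<not> sparse V N b (insert e F)"
    using F unfolding maximal_in_def by auto
  have FE: "F \<subseteq> E" and fF: "finite F" using FK K finite_sub by auto
  have le: "int (card (edges_in N F X)) \<le> b X" if "X \<subseteq> V" for X using sF that unfolding sparse_def by simp
  \<comment> \<open>Tight sets meeting in at least \<open>c\<close> vertices have a tight union, so the maximal ones form the family.\<close>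
  define T where "T = {X. X \<subseteq> V \<and> 2 \<le> card X \<and> int (card (edges_in N F X)) = b X}"
  define Q where "Q = {X \<in> T. \<forall>Y\<in>T. X \<subseteq> Y \<longrightarrow> Y = X}"
  have finT: "finite T" unfolding T_def using finite_V by simp
  have QV: "Q \<subseteq> Pow V" unfolding Q_def T_def by auto
  have Un: "X \<union> Y \<in> T" if XY: "X \<in> T" "Y \<in> T" "c \<le> card (X \<inter> Y)" for X Y
  proof -
    have V: "X \<subseteq> V" "Y \<subseteq> V" "2 \<le> card X" using XY unfolding T_def by auto
    have "card X \<le> card (X \<union> Y)" using V finite_sub by (intro card_mono) auto
    moreover have "b (X \<inter> Y) + b (X \<union> Y) \<le> b X + b Y"
      using sub V XY(3) unfolding intersecting_submodular_on_def by simp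
    moreover have "int (card (edges_in N F (X \<inter> Y))) \<le> b (X \<inter> Y)" "int (card (edges_in N F (X \<union> Y))) \<le> b (X \<union> Y)"
      using V by (auto intro!: le)
    moreover have "int (card (edges_in N F X)) = b X" "int (card (edges_in N F Y)) = b Y"
      using XY unfolding T_def by auto
    ultimately show ?thesis
      using V card_edges_in_supermodular[OF FE, of X Y] unfolding T_def by auto
  qed
  have dis: "card (Y \<inter> Z) < c" if "Y \<in> Q" "Z \<in> Q" "Y \<noteq> Z" for Y Z
  proof (rule ccontr)
    assume "\<not> card (Y \<inter> Z) < c"
    then have "Y \<union> Z \<in> T" using Un that unfolding Q_def by auto
    then have "Y \<union> Z = Y" "Y \<union> Z = Z" using that unfolding Q_def by auto
    then show False using that by simp
  qed
  then have pw: "pairwise (\<lambda>Y Z. card (Y \<inter> Z) < c) Q" by (auto simp: pairwise_def)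
  have "uncovered N K Q \<subseteq> F"
  proof
    fix e assume e: "e \<in> uncovered N K Q"
    show "e \<in> F"
    proof (rule ccontr)
      assume eF: "e \<notin> F"
      have eK: "e \<in> K" using e unfolding uncovered_def by auto
      \<comment> \<open>Before \<open>e\<close> was added, the bound at \<open>X\<close> held. So
        \<open>X\<close> contains both ends of \<open>e\<close>, the excess is exactly one edge, and
        \<open>X\<close> is tight for \<open>F\<close>.\<close>
      obtain X where X: "X \<subseteq> V" "b X < int (card (edges_in N (insert e F) X))"
        using mx[of e] eK eF fF unfolding sparse_def by (auto simp: not_le)
      have eX: "N e \<subseteq> X"
      proof (rule ccontr)
        assume "\<not> N e \<subseteq> X"
        then have "edges_in N (insert e F) X = edges_in N F X" unfolding edges_in_def by auto
        then show False using X le[OF X(1)] by simp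
      qed
      then have "edges_in N (insert e F) X = insert e (edges_in N F X)" "e \<notin> edges_in N F X"
        using eF unfolding edges_in_def by auto
      then have "int (card (edges_in N F X)) = b X" using X le[OF X(1)] fF by simp
      moreover have "card (N e) \<le> card X" using eX X finite_sub by (intro card_mono) auto
      ultimately have "X \<in> T" using X ends(2)[of e] eK K unfolding T_def by auto
      then obtain Y where "Y \<in> T" "X \<subseteq> Y" "\<forall>Z\<in>T. Y \<subseteq> Z \<longrightarrow> Y = Z"
        using finite_has_maximal2[OF finT, of X] by auto
      then have "Y \<in> Q" "N e \<subseteq> Y" using eX unfolding Q_def by auto
      then show False using e unfolding uncovered_def by auto
    qed
  qed
  then have "uncovered N F Q = uncovered N K Q" using FK unfolding uncovered_def by auto
  moreover have "card F = card (uncovered N F Q) + (\<Sum>Y\<in>Q. card (edges_in N F Y))"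
    by (intro card_edge_decomposition FE QV pairwise_mono[OF pw]) (use c in auto)
  moreover have "int (\<Sum>Y\<in>Q. card (edges_in N F Y)) = (\<Sum>Y\<in>Q. b Y)"
    unfolding of_nat_sum by (rule sum.cong) (auto simp: Q_def T_def)
  ultimately show ?thesis using that[OF QV pw] by simp
qed

text \<open>Weak duality: each admissible family bounds every sparse subset of \<open>K\<close>. As
  \<open>maximal_sparse_card\<close> attains such a bound, maximal sparse sets are maximum.\<close>

lemma sparse_card_le:
  assumes F: "F \<subseteq> K" "sparse V N b F" and K: "K \<subseteq> E" and Q: "Q \<subseteq> Pow V"
    and dis: "pairwise (\<lambda>Y Z. card (Y \<inter> Z) < 2) Q"
  shows "int (card F) \<le> int (card (uncovered N K Q)) + (\<Sum>Y\<in>Q. b Y)"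
proof -
  have "card F = card (uncovered N F Q) + (\<Sum>Y\<in>Q. card (edges_in N F Y))"
    using F K by (intro card_edge_decomposition Q dis) auto
  moreover have "card (uncovered N F Q) \<le> card (uncovered N K Q)"
    using F(1) K finite_sub by (intro card_mono) (auto simp: uncovered_def)
  moreover have "int (\<Sum>Y\<in>Q. card (edges_in N F Y)) \<le> (\<Sum>Y\<in>Q. b Y)"
    unfolding of_nat_sum using F(2) Q by (intro sum_mono) (auto simp: sparse_def)
  ultimately show ?thesis by linarith
qed

lemma sparse_empty: "(\<And>X. X \<subseteq> V \<Longrightarrow> 0 \<le> b X) \<Longrightarrow> sparse V N b {}"
  unfolding sparse_def edges_in_def by simp

lemma max_card_sparse:
  assumes c: "c \<le> 2" and sub: "intersecting_submodular_on c V b"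
    and nn: "\<And>X. X \<subseteq> V \<Longrightarrow> 0 \<le> b X" and K: "K \<subseteq> E" and F: "maximal_in (sparse V N b) K F"
  shows "max_card (sparse V N b) K \<le> int (card F)"
proof -
  obtain Q where Q: "Q \<subseteq> Pow V" "pairwise (\<lambda>Y Z. card (Y \<inter> Z) < c) Q"
    "int (card F) = int (card (uncovered N K Q)) + (\<Sum>Y\<in>Q. b Y)"
    by (rule maximal_sparse_card[OF c sub K F])
  obtain F' where F': "F' \<subseteq> K" "sparse V N b F'" "max_card (sparse V N b) K = int (card F')"
    by (rule max_card_attained[of K "sparse V N b", OF finite_sub(1)[OF K] sparse_empty[OF nn]])
  have "pairwise (\<lambda>Y Z. card (Y \<inter> Z) < 2) Q" by (rule pairwise_mono[OF Q(2)]) (use c in auto)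
  then show ?thesis using sparse_card_le[OF F'(1,2) K Q(1)] F'(3) Q(3) by simp
qed

lemma matroid_rank_sparse:
  assumes "c \<le> 2" and "intersecting_submodular_on c V b" and "\<And>X. X \<subseteq> V \<Longrightarrow> 0 \<le> b X"
  shows "matroid_rank E (max_card (sparse V N b))"
  using finite_E sparse_empty[OF assms(3)] sparse_mono max_card_sparse[OF assms]
  by (rule matroid_rank_max_card)

text \<open>Used with \<open>c = 1\<close>, where the family is disjoint, for \<open>l\<close>, and
  with \<open>c = 2\<close> for \<open>ell\<close>.\<close>

lemma max_card_sparse_formula:
  assumes c: "c \<le> 2" and sub: "intersecting_submodular_on c V b"
    and nn: "\<And>X. X \<subseteq> V \<Longrightarrow> 0 \<le> b X" and K: "K \<subseteq> E"
  obtains Q where "Q \<subseteq> Pow V" "pairwise (\<lambda>Y Z. card (Y \<inter> Z) < c) Q"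
    "max_card (sparse V N b) K = int (card (uncovered N K Q)) + (\<Sum>Y\<in>Q. b Y)"
proof -
  have fK: "finite K" using K finite_sub by simp
  obtain F where F: "maximal_in (sparse V N b) K F"
    by (rule extend_to_maximal_in[of K "{}" "sparse V N b", OF fK _ sparse_empty[OF nn]]) auto
  then have "int (card F) \<le> max_card (sparse V N b) K"
    using fK by (intro card_le_max_card) (auto simp: maximal_in_def)
  then have eq: "max_card (sparse V N b) K = int (card F)" using max_card_sparse[OF c sub nn K F] by simp
  show ?thesis using maximal_sparse_card[OF c sub K F] that eq by metis
qed

end

section \<open>Slack of set functions, partitions and degree sums\<close>

definition slack :: "('v set \<Rightarrow> int) \<Rightarrow> 'v set \<Rightarrow> int" where
  "slack f X = (\<Sum>v\<in>X. f {v}) - f X"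

definition degree_in :: "('e \<Rightarrow> 'v set) \<Rightarrow> 'e set \<Rightarrow> 'v \<Rightarrow> nat" where
  "degree_in N F v = card {e \<in> F. v \<in> N e}"

lemma slack_intersecting_submodular:
  assumes "finite V" "intersecting_supermodular_on c V f"
  shows "intersecting_submodular_on c V (slack f)"
  unfolding intersecting_submodular_on_def
proof (intro allI impI)
  fix A B assume AB: "A \<subseteq> V" "B \<subseteq> V" "c \<le> card (A \<inter> B)"
  have "finite A" "finite B" using AB assms(1) by (auto intro: finite_subset)
  then have "(\<Sum>v\<in>A \<union> B. f {v}) + (\<Sum>v\<in>A \<inter> B. f {v}) = (\<Sum>v\<in>A. f {v}) + (\<Sum>v\<in>B. f {v})"
    by (rule sum.union_inter)
  moreover have "f A + f B \<le> f (A \<inter> B) + f (A \<union> B)"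
    using assms(2) AB unfolding intersecting_supermodular_on_def by simp
  ultimately show "slack f (A \<inter> B) + slack f (A \<union> B) \<le> slack f A + slack f B"
    unfolding slack_def by linarith
qed

lemma subadditive_Union:
  assumes sub: "subadditive_on V f" and "finite P" "disjoint P" and "f {} = 0" and "Y \<subseteq> V"
  shows "f (Y \<inter> \<Union>P) \<le> (\<Sum>X\<in>P. f (Y \<inter> X))"
  using assms(2,3)
proof (induction P rule: finite_induct)
  case empty
  then show ?case using assms(4) by simp
next
  case (insert X P)
  have "X \<inter> Z = {}" if "Z \<in> P" for Z
    using insert.prems insert.hyps(2) that by (intro disjointD[of "insert X P"]) auto
  then have dis: "(Y \<inter> X) \<inter> (Y \<inter> \<Union>P) = {}" by auto
  have "disjoint P" using insert.prems by (simp add: pairwise_insert)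
  then have "f (Y \<inter> \<Union>P) \<le> (\<Sum>X\<in>P. f (Y \<inter> X))" by (rule insert.IH)
  moreover have "f ((Y \<inter> X) \<union> (Y \<inter> \<Union>P)) \<le> f (Y \<inter> X) + f (Y \<inter> \<Union>P)"
    using sub dis assms(5) unfolding subadditive_on_def by (simp add: le_infI1)
  moreover have "Y \<inter> \<Union>(insert X P) = (Y \<inter> X) \<union> (Y \<inter> \<Union>P)" by auto
  ultimately show ?case using insert.hyps by simp
qed

context edge_set
begin

lemma card_le_sum_degree_in:
  assumes "F \<subseteq> E" "W \<subseteq> V" "D \<subseteq> F" "\<And>e. e \<in> D \<Longrightarrow> N e \<inter> W \<noteq> {}"
  shows "card D \<le> (\<Sum>v\<in>W. degree_in N F v)"
proof -
  have fin: "finite F" "finite W" using assms finite_sub by auto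
  have "D \<subseteq> (\<Union>v\<in>W. {e \<in> F. v \<in> N e})" using assms(3,4) by fastforce
  then have "card D \<le> card (\<Union>v\<in>W. {e \<in> F. v \<in> N e})" using fin by (intro card_mono) auto
  also have "\<dots> \<le> (\<Sum>v\<in>W. degree_in N F v)" unfolding degree_in_def by (rule card_UN_le[OF fin(2)])
  finally show ?thesis .
qed

lemma sum_partition:
  assumes "partition_on V P"
  shows "(\<Sum>v\<in>V. h v) = (\<Sum>X\<in>P. \<Sum>v\<in>X. h v)"
proof -
  have PV: "\<Union>P = V" and dis: "disjoint P" using assms unfolding partition_on_def by auto
  have "\<forall>X\<in>P. finite X" using PV finite_sub(2) by blast
  moreover have "\<forall>X\<in>P. \<forall>Y\<in>P. X \<noteq> Y \<longrightarrow> X \<inter> Y = {}" using disjointD[OF dis] by simp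
  ultimately have "sum h (\<Union>P) = (\<Sum>X\<in>P. \<Sum>v\<in>X. h v)" by (simp add: sum.Union_disjoint)
  then show ?thesis using PV by simp
qed

text \<open>At most \<open>slack f X\<close> of the \<open>slack f V\<close> edges lie inside each
  part \<open>X\<close>; in the difference the sums of \<open>f {v}\<close> cancel.\<close>

lemma sparse_base_cross_edges:
  assumes F: "F \<subseteq> E" "sparse V N (slack f) F" "int (card F) = slack f V" and P: "partition_on V P"
  shows "(\<Sum>X\<in>P. f X) - f V \<le> int (card (uncovered N F P))"
proof -
  have PV: "\<Union>P = V" and dis: "disjoint P"
    using P unfolding partition_on_def by auto
  have PP: "P \<subseteq> Pow V" using PV by auto
  have "pairwise (\<lambda>Y Z. card (Y \<inter> Z) < 2) P" using disjointD[OF dis] by (intro pairwiseI) simp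
  then have "int (card F) \<le> int (card (uncovered N F P)) + (\<Sum>X\<in>P. slack f X)"
    by (rule sparse_card_le[OF order_refl F(2,1) PP])
  then show ?thesis using F(3) unfolding slack_def sum_subtractf sum_partition[OF P] by simp
qed

lemma handshake:
  assumes "F \<subseteq> E"
  shows "(\<Sum>v\<in>V. degree_in N F v) = 2 * card F"
proof -
  have fin: "finite F" using assms finite_sub by auto
  have "(\<Sum>v\<in>V. degree_in N F v) = (\<Sum>v\<in>V. \<Sum>e | e \<in> F \<and> v \<in> N e. 1)"
    unfolding degree_in_def by simp
  also have "\<dots> = (\<Sum>e\<in>F. \<Sum>v | v \<in> V \<and> v \<in> N e. 1)"
    by (rule sum.swap_restrict[OF finite_V fin])
  also have "\<dots> = (\<Sum>e\<in>F. 2)"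
  proof (rule sum.cong)
    fix e assume "e \<in> F"
    then have "{v. v \<in> V \<and> v \<in> N e} = N e" "card (N e) = 2" using ends[of e] assms by auto
    then show "(\<Sum>v | v \<in> V \<and> v \<in> N e. 1) = (2::nat)" by simp
  qed simp
  finally show ?thesis by simp
qed

end

section \<open>The rank inequality\<close>

text \<open>The edge set on the right of \<open>cut\<close> is the cut of \<open>A\<close> in the
  graph with \<open>B\<close> deleted, written without forming that graph.\<close>

locale packing_hypotheses = edge_set V E N
  for V :: "'v set" and E :: "'e set" and N :: "'e \<Rightarrow> 'v set" +
  fixes l ell :: "'v set \<Rightarrow> int"
  assumes l_nonneg: "nonnegative_set_function_on V l"
    and l_mono: "nonincreasing_on V l"
    and l_super: "intersecting_supermodular_on 1 V l"
    and ell_nonneg: "nonnegative_set_function_on V ell"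
    and ell_super: "intersecting_supermodular_on 2 V ell"
    and ell_sub: "subadditive_on V ell"
    and degree: "\<And>v. v \<in> V \<Longrightarrow> 2 * ell {v} + 2 * l {v} \<le> int (degree_in N E v)"
    and cut: "\<And>A B. A \<inter> B = {} \<Longrightarrow> A \<union> B \<subset> V \<Longrightarrow>
           slack ell (A \<union> B) < int (card (edges_in N E (A \<union> B))) \<Longrightarrow>
           2 * ell (A \<union> B) - (\<Sum>v\<in>B. ell {v}) + (if A = {} then 0 else 2 * l (A \<union> B)) \<le>
           int (card {e \<in> E. N e \<inter> B = {} \<and> card (N e \<inter> A) = 1})"
begin

definition dense :: "'v set \<Rightarrow> bool" where
  "dense Z \<longleftrightarrow> slack ell Z < int (card (edges_in N E Z))"

lemma nonneg: "X \<subseteq> V \<Longrightarrow> 0 \<le> l X" "X \<subseteq> V \<Longrightarrow> 0 \<le> ell X" "l {} = 0" "ell {} = 0"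
  using l_nonneg ell_nonneg unfolding nonnegative_set_function_on_def by auto

lemma l_antimono: "A \<noteq> {} \<Longrightarrow> A \<subseteq> B \<Longrightarrow> B \<subseteq> V \<Longrightarrow> l B \<le> l A"
  using l_mono unfolding nonincreasing_on_def by simp

text \<open>The sum of \<open>ell {v}\<close> splits exactly over the traces of \<open>Y\<close> on
  the parts, while \<open>ell\<close> itself is subadditive.\<close>

lemma slack_ell_partition:
  assumes P: "partition_on V P" and Y: "Y \<subseteq> V"
  shows "(\<Sum>X\<in>P. slack ell (Y \<inter> X)) \<le> slack ell Y"
proof -
  have PV: "\<Union>P = V" and dis: "disjoint P" and fP: "finite P"
    using P finite_elements[OF finite_V P] unfolding partition_on_def by auto
  have "Y = (\<Union>X\<in>P. Y \<inter> X)" using Y PV by auto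
  then have "(\<Sum>v\<in>Y. ell {v}) = (\<Sum>v\<in>(\<Union>X\<in>P. Y \<inter> X). ell {v})" by simp
  also have "\<dots> = (\<Sum>X\<in>P. \<Sum>v\<in>Y \<inter> X. ell {v})"
    using fP finite_sub(2)[OF Y] disjointD[OF dis] by (intro sum.UNION_disjoint) auto
  finally have "(\<Sum>v\<in>Y. ell {v}) = (\<Sum>X\<in>P. \<Sum>v\<in>Y \<inter> X. ell {v})" .
  moreover have "ell (Y \<inter> \<Union>P) \<le> (\<Sum>X\<in>P. ell (Y \<inter> X))"
    by (rule subadditive_Union[OF ell_sub fP dis nonneg(4) Y])
  moreover have "Y \<inter> \<Union>P = Y" using Y PV by auto
  ultimately show ?thesis unfolding slack_def sum_subtractf by simp
qed

text \<open>Split \<open>X\<close> into single vertices, which have slack 0.\<close>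

lemma slack_ell_nonneg:
  assumes X: "X \<subseteq> V"
  shows "0 \<le> slack ell X"
proof -
  have "partition_on V ((\<lambda>v. {v}) ` V)"
    unfolding partition_on_def pairwise_def disjnt_def by auto
  then have "(\<Sum>Z\<in>(\<lambda>v. {v}) ` V. slack ell (X \<inter> Z)) \<le> slack ell X"
    by (rule slack_ell_partition[OF _ X])
  moreover have "slack ell (X \<inter> {v}) = 0" for v
    using nonneg(4) unfolding slack_def by (cases "v \<in> X") auto
  then have "(\<Sum>Z\<in>(\<lambda>v. {v}) ` V. slack ell (X \<inter> Z)) = 0"
    by (intro sum.neutral) auto
  ultimately show ?thesis by simp
qed

lemma slack_l_nonneg:
  assumes X: "X \<subseteq> V"
  shows "0 \<le> slack l X"
proof (cases "X = {}")
  case True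
  then show ?thesis using nonneg(3) by (simp add: slack_def)
next
  case False
  then obtain v where v: "v \<in> X" by auto
  have "l X \<le> l {v}" using v X by (intro l_antimono) auto
  also have "l {v} \<le> (\<Sum>v\<in>X. l {v})"
    using v X nonneg(1) finite_sub(2)[OF X] by (intro member_le_sum) auto
  finally show ?thesis by (simp add: slack_def)
qed

lemma dense_card:
  assumes "Z \<subseteq> V" "dense Z"
  shows "2 \<le> card Z"
proof -
  have "edges_in N E Z \<noteq> {}" using assms slack_ell_nonneg[OF assms(1)] unfolding dense_def by auto
  then obtain e where "e \<in> E" "N e \<subseteq> Z" unfolding edges_in_def by auto
  then show ?thesis using ends(2)[of e] card_mono[OF finite_sub(2)[OF assms(1)], of "N e"] by auto
qed

text \<open>The cut condition with \<open>A = {}\<close> counts no edges, so it reads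
  \<open>2 * ell Z \<le> (\<Sum>v\<in>Z. ell {v})\<close>.\<close>

lemma slack_ge_half_sum:
  assumes "Z \<subset> V" "dense Z"
  shows "(\<Sum>v\<in>Z. ell {v}) \<le> 2 * slack ell Z"
  using cut[of "{}" Z] assms unfolding dense_def by (simp add: slack_def)

text \<open>A count, by ends in \<open>X\<close>, of the edges that no member of \<open>R\<close>
  contains. The first alternative is the price of the cut condition being available only for proper
  subsets of \<open>V\<close>.\<close>

lemma part_bound:
  assumes X: "X \<subseteq> V" "X \<noteq> {}" and R: "R \<subseteq> Pow X"
    and pw: "pairwise (\<lambda>Y Z. card (Y \<inter> Z) < 2) R"
    and dns: "\<And>Y. Y \<in> R \<Longrightarrow> dense Y" and proper: "V \<notin> R"
  shows "X = V \<and> (\<Sum>v\<in>X. ell {v}) \<le> (\<Sum>Y\<in>R. slack ell Y) \<or>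
    2 * l X + 2 * (\<Sum>v\<in>X. ell {v}) - 2 * (\<Sum>Y\<in>R. slack ell Y) \<le>
    (\<Sum>v\<in>X. int (degree_in N (uncovered N E R) v))"
proof -
  \<comment> \<open>\<open>m v\<close> is the number of members through \<open>v\<close>. In a
    member \<open>Y\<close>, \<open>A Y\<close> holds the vertices private to \<open>Y\<close> and
    \<open>B Y\<close> the shared ones; \<open>Z\<close> holds the vertices of \<open>X\<close> in
    no member.\<close>
  define m where "m v = card {Y \<in> R. v \<in> Y}" for v
  define A where "A Y = {v \<in> Y. m v < 2}" for Y
  define B where "B Y = {v \<in> Y. 2 \<le> m v}" for Y
  define Z where "Z = {v \<in> X. m v = 0}"
  define U where "U = uncovered N E R"
  have UE: "U \<subseteq> E" unfolding U_def uncovered_def by auto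
  have fX: "finite X" using X finite_sub by simp
  have fR: "finite R" using R fX by (simp add: finite_subset)
  have YX: "Y \<subseteq> X" if "Y \<in> R" for Y using R that by auto
  have YV: "Y \<subset> V" if "Y \<in> R" for Y using YX[OF that] X(1) proper that by auto
  have a0: "0 \<le> ell {v}" if "v \<in> X" for v using that X by (intro nonneg(2)) auto
  have m0: "m v = 0 \<longleftrightarrow> (\<forall>Y\<in>R. v \<notin> Y)" for v unfolding m_def using fR by auto
  have mA: "Y = Y'" if "v \<in> A Y" "Y \<in> R" "Y' \<in> R" "v \<in> Y'" for v Y Y'
  proof (rule ccontr)
    assume "Y \<noteq> Y'"
    then have "card {Y, Y'} = 2" by simp
    moreover have "card {Y, Y'} \<le> m v" unfolding m_def using that fR by (intro card_mono) (auto simp: A_def)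
    ultimately show False using that(1) unfolding A_def by simp
  qed
  have swap: "(\<Sum>Y\<in>R. \<Sum>v | v \<in> X \<and> v \<in> Y. g v) = (\<Sum>v\<in>X. int (m v) * g v)" for g
    unfolding sum.swap_restrict[OF fR fX] m_def by simp
  have sumY: "(\<Sum>Y\<in>R. \<Sum>v\<in>Y. ell {v}) = (\<Sum>v\<in>X. int (m v) * ell {v})"
  proof -
    have "(\<Sum>Y\<in>R. \<Sum>v\<in>Y. ell {v}) = (\<Sum>Y\<in>R. \<Sum>v | v \<in> X \<and> v \<in> Y. ell {v})"
      using YX by (intro sum.cong) auto
    then show ?thesis using swap by simp
  qed
  have sumB: "(\<Sum>Y\<in>R. \<Sum>v\<in>B Y. ell {v}) = (\<Sum>v\<in>X. int (m v) * (if 2 \<le> m v then ell {v} else 0))"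
  proof -
    have "(\<Sum>v\<in>B Y. ell {v}) = (\<Sum>v | v \<in> X \<and> v \<in> Y. if 2 \<le> m v then ell {v} else 0)"
      if "Y \<in> R" for Y
      using YX[OF that] fX unfolding B_def
      by (intro sum.mono_neutral_cong_left) (auto intro: finite_subset)
    then show ?thesis using swap[of "\<lambda>v. if 2 \<le> m v then ell {v} else 0"] by simp
  qed
  have AB: "A Y \<inter> B Y = {}" "A Y \<union> B Y = Y" for Y unfolding A_def B_def by auto
  have degA: "2 * ell Y - (\<Sum>v\<in>B Y. ell {v}) + (if A Y = {} then 0 else 2 * l Y) \<le>
      (\<Sum>v\<in>A Y. int (degree_in N U v))" if Y: "Y \<in> R" for Y
  proof -
    let ?D = "{e \<in> E. N e \<inter> B Y = {} \<and> card (N e \<inter> A Y) = 1}"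
    have nonemp: "N e \<inter> A Y \<noteq> {}" if "e \<in> ?D" for e using that by auto
    \<comment> \<open>An edge of \<open>?D\<close> has an end private to \<open>Y\<close>, so only
      \<open>Y\<close> could contain it; having just one end in \<open>A Y\<close> and none in
      \<open>B Y\<close>, it leaves \<open>Y\<close>.\<close>
    have "?D \<subseteq> U"
    proof
      fix e assume e: "e \<in> ?D"
      obtain v where v: "v \<in> N e" "v \<in> A Y" using nonemp[OF e] by auto
      have "\<not> N e \<subseteq> Y'" if Y': "Y' \<in> R" for Y'
      proof
        assume sub: "N e \<subseteq> Y'"
        then have "Y' = Y" using mA[OF v(2) Y Y'] v by auto
        then have "N e \<inter> A Y = N e" using sub e AB(2)[of Y] by auto
        then show False using e ends(2)[of e] by auto
      qed
      then show "e \<in> U" using e unfolding U_def uncovered_def by auto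
    qed
    then have "card ?D \<le> (\<Sum>v\<in>A Y. degree_in N U v)"
      using nonemp YV[OF Y] by (intro card_le_sum_degree_in[OF UE]) (auto simp: A_def)
    moreover have "2 * ell (A Y \<union> B Y) - (\<Sum>v\<in>B Y. ell {v}) + (if A Y = {} then 0 else 2 * l (A Y \<union> B Y)) \<le> int (card ?D)"
      using YV[OF Y] dns[OF Y] unfolding dense_def by (intro cut) (simp_all add: AB)
    ultimately show ?thesis unfolding AB(2) of_nat_sum[symmetric] by linarith
  qed
  \<comment> \<open>No member meets \<open>v\<close>, so all its edges are uncovered and the degree
    hypothesis applies in full.\<close>
  have degZ: "2 * ell {v} + 2 * l {v} \<le> int (degree_in N U v)" if v: "v \<in> Z" for v
  proof -
    have "{e \<in> E. v \<in> N e} = {e \<in> U. v \<in> N e}"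
      using v m0[of v] unfolding Z_def U_def uncovered_def by auto
    then show ?thesis using degree[of v] v X unfolding degree_in_def Z_def by auto
  qed
  show ?thesis
  \<comment> \<open>First case: every vertex of \<open>X\<close> is shared. Then each vertex is
    counted at least twice, which cancels the factor 1/2 of
    \<open>slack_ge_half_sum\<close>.\<close>
  proof (cases "Z = {} \<and> (\<forall>Y\<in>R. A Y = {})")
    case True
    have m2: "2 \<le> m v" if v: "v \<in> X" for v
    proof -
      have "m v \<noteq> 0" using True v unfolding Z_def by auto
      then obtain Y where "Y \<in> R" "v \<in> Y" using m0 by auto
      then show ?thesis using True unfolding A_def by fastforce
    qed
    have "2 * (\<Sum>v\<in>X. ell {v}) \<le> (\<Sum>v\<in>X. int (m v) * ell {v})"
      unfolding sum_distrib_left using m2 a0 by (intro sum_mono mult_right_mono) auto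
    also have "\<dots> = (\<Sum>Y\<in>R. \<Sum>v\<in>Y. ell {v})" using sumY by simp
    also have "\<dots> \<le> (\<Sum>Y\<in>R. 2 * slack ell Y)" using YV dns by (intro sum_mono slack_ge_half_sum) auto
    finally have le: "(\<Sum>v\<in>X. ell {v}) \<le> (\<Sum>Y\<in>R. slack ell Y)" by (simp add: sum_distrib_left[symmetric])
    show ?thesis
    proof (cases "X = V")
      case True
      then show ?thesis using le by simp
    next
      case False
      obtain v where "v \<in> X" using X by auto
      then have "R \<noteq> {}" using m2[of v] unfolding m_def by auto
      then have cR: "1 \<le> card R" using fR by (simp add: Suc_leI card_gt_0_iff)
      \<comment> \<open>Each dense member has at least one edge beyond its slack. As
        \<open>R\<close> is nonempty, the edges inside members alone already exceed the total slack,
        hence \<open>slack ell X\<close>.\<close>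
      have "dense X"
      proof -
        have "slack ell X \<le> (\<Sum>Y\<in>R. slack ell Y)" using le nonneg(2)[OF X(1)] unfolding slack_def[of ell X] by simp
        also have "\<dots> < (\<Sum>Y\<in>R. slack ell Y + 1)" using cR by (simp add: sum.distrib)
        also have "\<dots> \<le> (\<Sum>Y\<in>R. int (card (edges_in N E Y)))"
          using dns unfolding dense_def by (intro sum_mono) force
        also have "\<dots> = int (\<Sum>Y\<in>R. card (edges_in N (edges_in N E X) Y))"
          unfolding of_nat_sum
        proof (rule sum.cong)
          fix Y assume "Y \<in> R"
          then have "edges_in N E Y = edges_in N (edges_in N E X) Y" using YX unfolding edges_in_def by auto
          then show "int (card (edges_in N E Y)) = int (card (edges_in N (edges_in N E X) Y))" by simp
        qed simp
        also have "\<dots> \<le> int (card (edges_in N E X))"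
        proof -
          have "R \<subseteq> Pow V" "edges_in N E X \<subseteq> E" using R X(1) by (auto simp: edges_in_def)
          then show ?thesis using card_edge_decomposition[OF _ _ pw, of "edges_in N E X"] by simp
        qed
        finally show ?thesis unfolding dense_def .
      qed
      \<comment> \<open>The cut condition with \<open>A = X\<close> and \<open>B = {}\<close>. All
        edges leaving \<open>X\<close> are uncovered because members lie in \<open>X\<close>; the
        term \<open>2 * ell X\<close> is dropped later as nonnegative.\<close>
      then have "2 * ell (X \<union> {}) - (\<Sum>v\<in>{}. ell {v}) + (if X = {} then 0 else 2 * l (X \<union> {}))
          \<le> int (card {e \<in> E. N e \<inter> {} = {} \<and> card (N e \<inter> X) = 1})"
        using X False unfolding dense_def by (intro cut) auto
      moreover have "card {e \<in> E. card (N e \<inter> X) = 1} \<le> (\<Sum>v\<in>X. degree_in N U v)"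
      proof (intro card_le_sum_degree_in UE X(1) subsetI)
        fix e assume e: "e \<in> {e \<in> E. card (N e \<inter> X) = 1}"
        have "\<not> N e \<subseteq> Y" if "Y \<in> R" for Y
        proof
          assume "N e \<subseteq> Y"
          then have "N e \<inter> X = N e" using YX[OF that] by auto
          then show False using e ends(2)[of e] by auto
        qed
        then show "e \<in> U" using e unfolding U_def uncovered_def by auto
      next
        fix e assume "e \<in> {e \<in> E. card (N e \<inter> X) = 1}"
        then show "N e \<inter> X \<noteq> {}" by auto
      qed
      ultimately have "2 * l X \<le> int (\<Sum>v\<in>X. degree_in N U v)"
        using X nonneg(2)[OF X(1)] by (simp del: of_nat_sum)
      then have "2 * l X \<le> (\<Sum>v\<in>X. int (degree_in N U v))" by simp
      then show ?thesis using le unfolding U_def by linarith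
    qed
  next
    case False
    have lY: "0 \<le> l Y" if "Y \<in> R" for Y using YV[OF that] by (intro nonneg(1)) auto
    have lv: "0 \<le> l {v}" if "v \<in> Z" for v using that X by (intro nonneg(1)) (auto simp: Z_def)
    have lZ: "0 \<le> (\<Sum>v\<in>Z. l {v})" "0 \<le> (\<Sum>Y\<in>R. if A Y = {} then 0 else l Y)"
      using lY lv by (auto intro!: sum_nonneg)
    \<comment> \<open>One term suffices, since \<open>l\<close> is nonincreasing: a vertex of
      \<open>Z\<close>, or a member with a private vertex, has value at least
      \<open>l X\<close>.\<close>
    have L: "l X \<le> (\<Sum>v\<in>Z. l {v}) + (\<Sum>Y\<in>R. if A Y = {} then 0 else l Y)"
    proof (cases "Z = {}")
      case Zne: False
      then obtain v where v: "v \<in> Z" by auto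
      have "l X \<le> l {v}" using v X by (intro l_antimono) (auto simp: Z_def)
      also have "l {v} \<le> (\<Sum>v\<in>Z. l {v})"
        using v lv fX by (intro member_le_sum) (auto simp: Z_def)
      finally show ?thesis using lZ by simp
    next
      case True
      then obtain Y where Y: "Y \<in> R" "A Y \<noteq> {}" using False by auto
      have "l X \<le> l Y" using Y YX[OF Y(1)] X by (intro l_antimono) (auto simp: A_def)
      also have "l Y = (if A Y = {} then 0 else l Y)" using Y by simp
      also have "\<dots> \<le> (\<Sum>Y\<in>R. if A Y = {} then 0 else l Y)"
        using Y(1) lY fR by (intro member_le_sum) auto
      finally show ?thesis using lZ by simp
    qed
    have "(\<Sum>v\<in>Z. int (degree_in N U v)) + (\<Sum>Y\<in>R. \<Sum>v\<in>A Y. int (degree_in N U v)) \<le>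
        (\<Sum>v\<in>X. int (degree_in N U v))"
    proof -
      have fA: "finite (A Y)" if "Y \<in> R" for Y
        using YX[OF that] fX unfolding A_def by (auto intro: finite_subset)
      have "(\<Sum>Y\<in>R. \<Sum>v\<in>A Y. int (degree_in N U v)) = (\<Sum>v\<in>(\<Union>Y\<in>R. A Y). int (degree_in N U v))"
      proof (rule sum.UNION_disjoint[symmetric, OF fR])
        show "\<forall>Y\<in>R. finite (A Y)" using fA by simp
        show "\<forall>Y\<in>R. \<forall>Y'\<in>R. Y \<noteq> Y' \<longrightarrow> A Y \<inter> A Y' = {}"
        proof (intro ballI impI)
          fix Y Y' assume Y: "Y \<in> R" "Y' \<in> R" "Y \<noteq> Y'"
          show "A Y \<inter> A Y' = {}"
          proof (rule ccontr)
            assume "A Y \<inter> A Y' \<noteq> {}"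
            then obtain v where "v \<in> A Y" "v \<in> Y'" unfolding A_def by auto
            then show False using mA Y by metis
          qed
        qed
      qed
      moreover have "(\<Sum>v\<in>Z. int (degree_in N U v)) + (\<Sum>v\<in>(\<Union>Y\<in>R. A Y). int (degree_in N U v))
          = (\<Sum>v\<in>Z \<union> (\<Union>Y\<in>R. A Y). int (degree_in N U v))"
      proof (rule sum.union_disjoint[symmetric])
        show "finite Z" using fX unfolding Z_def by simp
        show "finite (\<Union>Y\<in>R. A Y)" using fR fA by auto
        show "Z \<inter> (\<Union>Y\<in>R. A Y) = {}" using m0 unfolding Z_def A_def by auto
      qed
      moreover have "Z \<union> (\<Union>Y\<in>R. A Y) \<subseteq> X" using YX unfolding Z_def A_def by auto
      then have "(\<Sum>v\<in>Z \<union> (\<Union>Y\<in>R. A Y). int (degree_in N U v)) \<le> (\<Sum>v\<in>X. int (degree_in N U v))"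
        using fX by (intro sum_mono2) auto
      ultimately show ?thesis by simp
    qed
    moreover have "(\<Sum>v\<in>Z. 2 * ell {v} + 2 * l {v}) \<le> (\<Sum>v\<in>Z. int (degree_in N U v))"
      using degZ by (intro sum_mono)
    moreover have "(\<Sum>Y\<in>R. 2 * ell Y - (\<Sum>v\<in>B Y. ell {v}) + 2 * (if A Y = {} then 0 else l Y)) \<le>
        (\<Sum>Y\<in>R. \<Sum>v\<in>A Y. int (degree_in N U v))"
    proof (rule sum_mono)
      fix Y assume "Y \<in> R"
      then show "2 * ell Y - (\<Sum>v\<in>B Y. ell {v}) + 2 * (if A Y = {} then 0 else l Y) \<le> (\<Sum>v\<in>A Y. int (degree_in N U v))"
        using degA[of Y] by (cases "A Y = {}") auto
    qed
    moreover have "(\<Sum>v\<in>Z. ell {v}) = (\<Sum>v\<in>X. if m v = 0 then ell {v} else 0)"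
      unfolding Z_def using fX by (simp add: sum.inter_filter)
    \<comment> \<open>Vertex by vertex: equality for \<open>m v = 0\<close> and
      \<open>m v = 1\<close>; for \<open>m v \<ge> 2\<close> the claim is
      \<open>2 * ell {v} \<le> m v * ell {v}\<close>. It converts the cut bounds into
      slacks.\<close>
    moreover have "2 * (\<Sum>v\<in>X. ell {v}) - 2 * (\<Sum>v\<in>X. int (m v) * ell {v}) \<le>
        2 * (\<Sum>v\<in>X. if m v = 0 then ell {v} else 0)
         - (\<Sum>v\<in>X. int (m v) * (if 2 \<le> m v then ell {v} else 0))"
      unfolding sum_distrib_left sum_subtractf[symmetric]
    proof (rule sum_mono)
      fix v assume v: "v \<in> X"
      consider "m v = 0" | "m v = 1" | "2 \<le> m v" by linarith
      then show "2 * ell {v} - 2 * (int (m v) * ell {v}) \<le>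
         2 * (if m v = 0 then ell {v} else 0) - int (m v) * (if 2 \<le> m v then ell {v} else 0)"
      proof cases
        case 3
        then have "2 * ell {v} \<le> int (m v) * ell {v}" using a0[OF v] by (intro mult_right_mono) auto
        moreover have "m v \<noteq> 0" using 3 by simp
        ultimately show ?thesis using 3 by simp
      qed simp_all
    qed
    moreover have "(\<Sum>Y\<in>R. slack ell Y) = (\<Sum>v\<in>X. int (m v) * ell {v}) - (\<Sum>Y\<in>R. ell Y)"
      unfolding slack_def sum_subtractf sumY ..
    ultimately show ?thesis using L unfolding U_def[symmetric] sum.distrib sum_subtractf sumB
      by (simp add: sum_distrib_left[symmetric])
  qed
qed

section \<open>Refinement to dense members and the global count\<close>

lemma refine_to_dense:
  assumes P: "partition_on V P" and Q: "Q \<subseteq> Pow V" and pw: "pairwise (\<lambda>Y Z. card (Y \<inter> Z) < 2) Q"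
    and E': "E' \<subseteq> E"
  obtains R where "R \<subseteq> Pow V" "pairwise (\<lambda>Y Z. card (Y \<inter> Z) < 2) R" "\<And>Z. Z \<in> R \<Longrightarrow> dense Z"
    "\<And>Z. Z \<in> R \<Longrightarrow> \<exists>X\<in>P. Z \<subseteq> X"
    "int (card (uncovered N E' R)) + (\<Sum>Z\<in>R. slack ell Z) \<le>
     int (card (uncovered N E' P \<union> uncovered N E' Q)) + (\<Sum>Y\<in>Q. slack ell Y)"
proof -
  have PV: "\<Union>P = V" and dis: "disjoint P" and fP: "finite P"
    using P finite_elements[OF finite_V P] unfolding partition_on_def by auto
  have fQ: "finite Q" using Q finite_family by simp
  have fE': "finite E'" using E' finite_sub by simp
  \<comment> \<open>Pairs are used as indices because different pairs may have the same
    intersection. On dense intersections \<open>g\<close> is injective: distinct pairs meet in at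
    most one vertex, a dense set has two.\<close>
  define g :: "'v set \<times> 'v set \<Rightarrow> 'v set" where "g p = fst p \<inter> snd p" for p
  define I where "I = {p \<in> Q \<times> P. dense (g p)}"
  define J where "J = {p \<in> Q \<times> P. \<not> dense (g p)}"
  have fin: "finite I" "finite J" using fP fQ unfolding I_def J_def by auto
  have gV: "g p \<subseteq> V" if "p \<in> Q \<times> P" for p
  proof -
    have "fst p \<subseteq> V" using that subsetD[OF Q, of "fst p"] by auto
    then show ?thesis unfolding g_def by auto
  qed
  have meet: "card (g p \<inter> g q) < 2" if p: "p \<in> I" and q: "q \<in> I" and pq: "p \<noteq> q" for p q
  proof (cases "fst p = fst q")
    case True
    then have "snd p \<noteq> snd q" using pq by (simp add: prod_eq_iff)
    then have "snd p \<inter> snd q = {}" using p q by (intro disjointD[OF dis]) (auto simp: I_def)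
    then have "g p \<inter> g q = {}" unfolding g_def by auto
    then show ?thesis by simp
  next
    case False
    then have "card (fst p \<inter> fst q) < 2" using p q by (intro pairwiseD[OF pw]) (auto simp: I_def)
    moreover have "fst p \<in> Q" using p by (auto simp: I_def)
    then have "fst p \<subseteq> V" using Q by auto
    then have "card (g p \<inter> g q) \<le> card (fst p \<inter> fst q)"
      using finite_sub(2) by (intro card_mono) (auto simp: g_def)
    ultimately show ?thesis by simp
  qed
  have inj: "inj_on g I"
  proof (rule inj_onI, rule ccontr)
    fix p q assume p: "p \<in> I" and q: "q \<in> I" and eq: "g p = g q" and "p \<noteq> q"
    then have "card (g p) < 2" using meet[of p q] by simp
    moreover have "2 \<le> card (g p)" using p gV by (intro dense_card) (auto simp: I_def)
    ultimately show False by simp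
  qed
  show ?thesis
  proof (rule that[of "g ` I"])
    show "g ` I \<subseteq> Pow V" using gV by (auto simp: I_def)
    show "pairwise (\<lambda>Y Z. card (Y \<inter> Z) < 2) (g ` I)"
    proof (rule pairwiseI)
      fix Y Z assume "Y \<in> g ` I" "Z \<in> g ` I" "Y \<noteq> Z"
      then obtain p q where "p \<in> I" "q \<in> I" "Y = g p" "Z = g q" by auto
      then show "card (Y \<inter> Z) < 2" using \<open>Y \<noteq> Z\<close> meet[of p q] by auto
    qed
    show "dense Z" if "Z \<in> g ` I" for Z using that by (auto simp: I_def)
    show "\<exists>X\<in>P. Z \<subseteq> X" if "Z \<in> g ` I" for Z using that by (auto simp: I_def g_def)
    \<comment> \<open>An edge covered by both \<open>P\<close> and \<open>Q\<close> lies in some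
      intersection; if the refined family misses it, that intersection was discarded as not
      dense.\<close>
    have "uncovered N E' (g ` I) \<subseteq> (uncovered N E' P \<union> uncovered N E' Q) \<union> (\<Union>p\<in>J. edges_in N E (g p))"
    proof
      fix e assume e: "e \<in> uncovered N E' (g ` I)"
      show "e \<in> (uncovered N E' P \<union> uncovered N E' Q) \<union> (\<Union>p\<in>J. edges_in N E (g p))"
      proof (cases "e \<in> uncovered N E' P \<union> uncovered N E' Q")
        case False
        then obtain X Y where XY: "X \<in> P" "Y \<in> Q" "N e \<subseteq> X" "N e \<subseteq> Y" "e \<in> E'"
          using e unfolding uncovered_def by auto
        then have sub: "N e \<subseteq> g (Y, X)" unfolding g_def by auto
        have "(Y, X) \<notin> I"
        proof
          assume "(Y, X) \<in> I"
          then show False using e sub unfolding uncovered_def by blast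
        qed
        then have "(Y, X) \<in> J" using XY unfolding I_def J_def by auto
        moreover have "e \<in> edges_in N E (g (Y, X))" using sub XY E' unfolding edges_in_def by auto
        ultimately show ?thesis by (intro UnI2 UN_I)
      qed simp
    qed
    then have "card (uncovered N E' (g ` I)) \<le>
        card ((uncovered N E' P \<union> uncovered N E' Q) \<union> (\<Union>p\<in>J. edges_in N E (g p)))"
      using fE' fin finite_E by (intro card_mono) auto
    also have "\<dots> \<le> card (uncovered N E' P \<union> uncovered N E' Q) + card (\<Union>p\<in>J. edges_in N E (g p))"
      by (rule card_Un_le)
    also have "card (\<Union>p\<in>J. edges_in N E (g p)) \<le> (\<Sum>p\<in>J. card (edges_in N E (g p)))"
      by (rule card_UN_le[OF fin(2)])
    finally have c: "card (uncovered N E' (g ` I)) \<le> card (uncovered N E' P \<union> uncovered N E' Q) +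
        (\<Sum>p\<in>J. card (edges_in N E (g p)))" by simp
    have "int (\<Sum>p\<in>J. card (edges_in N E (g p))) \<le> (\<Sum>p\<in>J. slack ell (g p))"
      unfolding of_nat_sum by (rule sum_mono) (auto simp: J_def dense_def)
    moreover have "(\<Sum>Z\<in>g ` I. slack ell Z) = (\<Sum>p\<in>I. slack ell (g p))"
      by (simp add: sum.reindex[OF inj])
    moreover have "(\<Sum>p\<in>I. slack ell (g p)) + (\<Sum>p\<in>J. slack ell (g p)) = (\<Sum>p\<in>Q \<times> P. slack ell (g p))"
    proof -
      have "Q \<times> P = I \<union> J" "I \<inter> J = {}" unfolding I_def J_def by auto
      then show ?thesis using sum.union_disjoint[OF fin] by metis
    qed
    moreover have "(\<Sum>p\<in>Q \<times> P. slack ell (g p)) = (\<Sum>Y\<in>Q. \<Sum>X\<in>P. slack ell (Y \<inter> X))"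
      unfolding g_def by (simp add: sum.cartesian_product split_beta)
    moreover have "\<dots> \<le> (\<Sum>Y\<in>Q. slack ell Y)"
      using Q by (intro sum_mono slack_ell_partition[OF P]) auto
    ultimately show "int (card (uncovered N E' (g ` I))) + (\<Sum>Z\<in>g ` I. slack ell Z) \<le>
       int (card (uncovered N E' P \<union> uncovered N E' Q)) + (\<Sum>Y\<in>Q. slack ell Y)"
      using c by linarith
  qed
qed

text \<open>Summing \<open>part_bound\<close> over \<open>P\<close> and halving by the handshake
  identity gives the bound for \<open>E\<close> with \<open>l V + ell V\<close> to spare, which pays
  for the removal of \<open>M\<close>.\<close>

lemma dense_family_bound:
  assumes P: "partition_on V P" and R: "R \<subseteq> Pow V" and pw: "pairwise (\<lambda>Y Z. card (Y \<inter> Z) < 2) R"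
    and dns: "\<And>Z. Z \<in> R \<Longrightarrow> dense Z" and part: "\<And>Z. Z \<in> R \<Longrightarrow> \<exists>X\<in>P. Z \<subseteq> X"
    and M: "M \<subseteq> E" "int (card M) \<le> l V + ell V"
  shows "(\<Sum>X\<in>P. l X) - l V + slack ell V \<le> int (card (uncovered N (E - M) R)) + (\<Sum>Z\<in>R. slack ell Z)"
proof -
  have PV: "\<Union>P = V" and dis: "disjoint P" and ne: "{} \<notin> P" and fP: "finite P"
    using P finite_elements[OF finite_V P] unfolding partition_on_def by auto
  have fR: "finite R" using R finite_family by simp
  have P_single: "P = {V}" if "V \<in> P"
  proof -
    have "X \<in> {V}" if X: "X \<in> P" for X
    proof (rule ccontr)
      assume "X \<notin> {V}"
      then have "X \<noteq> V" by simp
      then have "X \<inter> V = {}" using X \<open>V \<in> P\<close> by (intro disjointD[OF dis])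
      moreover have "X \<subseteq> V" "X \<noteq> {}" using X PV ne by auto
      ultimately show False by auto
    qed
    then have "P \<subseteq> {V}" by (rule subsetI)
    then show ?thesis using that by auto
  qed
  have snn: "0 \<le> slack ell Z" if "Z \<in> R" for Z using that R by (intro slack_ell_nonneg) auto
  show ?thesis
  \<comment> \<open>If \<open>V\<close> is a member, then \<open>P = {V}\<close>, the
    \<open>l\<close> terms cancel, and the slack of this member alone suffices.\<close>
  proof (cases "V \<in> R")
    case True
    then obtain X where "X \<in> P" "V \<subseteq> X" using part by auto
    moreover from this have "X = V" using PV by auto
    ultimately have "P = {V}" using P_single by simp
    moreover have "slack ell V \<le> (\<Sum>Z\<in>R. slack ell Z)"
      using True snn fR by (intro member_le_sum) auto
    ultimately show ?thesis by simp
  next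
    case proper: False
    define RX where "RX X = {Z \<in> R. Z \<subseteq> X}" for X
    define U where "U = uncovered N E R"
    have UE: "U \<subseteq> E" unfolding U_def uncovered_def by auto
    have bound: "X = V \<and> (\<Sum>v\<in>X. ell {v}) \<le> (\<Sum>Y\<in>RX X. slack ell Y) \<or>
        2 * l X + 2 * (\<Sum>v\<in>X. ell {v}) - 2 * (\<Sum>Y\<in>RX X. slack ell Y) \<le>
        (\<Sum>v\<in>X. int (degree_in N (uncovered N E (RX X)) v))" if X: "X \<in> P" for X
    proof (rule part_bound)
      show "X \<subseteq> V" "X \<noteq> {}" using X PV ne by auto
      show "pairwise (\<lambda>Y Z. card (Y \<inter> Z) < 2) (RX X)" by (rule pairwise_subset[OF pw]) (auto simp: RX_def)
    qed (use dns proper in \<open>auto simp: RX_def\<close>)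
    show ?thesis
    \<comment> \<open>The exceptional alternative of \<open>part_bound\<close>: again
      \<open>P = {V}\<close>, and \<open>slack ell V\<close> is at most the sum of
      \<open>ell {v}\<close> because \<open>ell V\<close> is nonnegative.\<close>
    proof (cases "V \<in> P \<and> (\<Sum>v\<in>V. ell {v}) \<le> (\<Sum>Y\<in>RX V. slack ell Y)")
      case True
      moreover have "RX V = R" using R unfolding RX_def by auto
      ultimately show ?thesis using P_single nonneg(2)[of V] by (simp add: slack_def[of ell V])
    next
      case False
      \<comment> \<open>A member through a vertex of \<open>X\<close> lies inside \<open>X\<close>,
        so the other members cover no edge at that vertex.\<close>
      have deg: "degree_in N (uncovered N E (RX X)) v = degree_in N U v" if X: "X \<in> P" "v \<in> X" for X v
      proof -
        have "Z \<subseteq> X" if Z: "Z \<in> R" "v \<in> Z" for Z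
        proof -
          obtain X' where X': "X' \<in> P" "Z \<subseteq> X'" using part[OF Z(1)] by auto
          have "X' = X"
          proof (rule ccontr)
            assume "X' \<noteq> X"
            then have "X' \<inter> X = {}" using X X' by (intro disjointD[OF dis])
            then show False using X X' Z by auto
          qed
          then show ?thesis using X' by simp
        qed
        then have "{e \<in> uncovered N E (RX X). v \<in> N e} = {e \<in> U. v \<in> N e}"
          unfolding uncovered_def U_def RX_def by blast
        then show ?thesis unfolding degree_in_def by simp
      qed
      have sumR: "(\<Sum>X\<in>P. \<Sum>Z\<in>RX X. slack ell Z) = (\<Sum>Z\<in>R. slack ell Z)"
      proof -
        have "R = (\<Union>X\<in>P. RX X)" using part unfolding RX_def by auto
        moreover have "(\<Sum>Z\<in>(\<Union>X\<in>P. RX X). slack ell Z) = (\<Sum>X\<in>P. \<Sum>Z\<in>RX X. slack ell Z)"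
        proof (rule sum.UNION_disjoint[OF fP])
          show "\<forall>X\<in>P. finite (RX X)" using fR unfolding RX_def by simp
          show "\<forall>X\<in>P. \<forall>X'\<in>P. X \<noteq> X' \<longrightarrow> RX X \<inter> RX X' = {}"
          proof (intro ballI impI)
            fix X X' assume XX: "X \<in> P" "X' \<in> P" "X \<noteq> X'"
            have False if Z: "Z \<in> RX X" "Z \<in> RX X'" for Z
            proof -
              have "X \<inter> X' = {}" by (rule disjointD[OF dis XX])
              then have "Z = {}" using Z unfolding RX_def by auto
              moreover have "Z \<subseteq> V" "dense Z" using Z R dns unfolding RX_def by auto
              then have "2 \<le> card Z" by (rule dense_card)
              ultimately show False by simp
            qed
            then show "RX X \<inter> RX X' = {}" by auto
          qed
        qed
        ultimately show ?thesis by simp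
      qed
      have "2 * (\<Sum>X\<in>P. l X) + 2 * (\<Sum>v\<in>V. ell {v}) - 2 * (\<Sum>Z\<in>R. slack ell Z) =
          (\<Sum>X\<in>P. 2 * l X + 2 * (\<Sum>v\<in>X. ell {v}) - 2 * (\<Sum>Y\<in>RX X. slack ell Y))"
        by (simp add: sum_partition[OF P] sumR[symmetric] sum.distrib sum_subtractf sum_distrib_left)
      also have "\<dots> \<le> (\<Sum>X\<in>P. \<Sum>v\<in>X. int (degree_in N U v))"
      proof (rule sum_mono)
        fix X assume X: "X \<in> P"
        have "(\<Sum>v\<in>X. int (degree_in N (uncovered N E (RX X)) v)) = (\<Sum>v\<in>X. int (degree_in N U v))"
          using deg[OF X] by simp
        then show "2 * l X + 2 * (\<Sum>v\<in>X. ell {v}) - 2 * (\<Sum>Y\<in>RX X. slack ell Y) \<le> (\<Sum>v\<in>X. int (degree_in N U v))"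
          using bound[OF X] False X by auto
      qed
      also have "\<dots> = int (\<Sum>v\<in>V. degree_in N U v)" unfolding of_nat_sum by (rule sum_partition[OF P, symmetric])
      also have "\<dots> = 2 * int (card U)" using handshake[OF UE] by simp
      finally have "(\<Sum>X\<in>P. l X) + (\<Sum>v\<in>V. ell {v}) - (\<Sum>Z\<in>R. slack ell Z) \<le> int (card U)" by simp
      moreover have "card U \<le> card (uncovered N (E - M) R) + card M"
      proof -
        have "card U \<le> card (uncovered N (E - M) R \<union> M)"
          using finite_E M finite_sub by (intro card_mono) (auto simp: U_def uncovered_def)
        then show ?thesis using card_Un_le[of "uncovered N (E - M) R" M] by simp
      qed
      ultimately show ?thesis using M(2) by (simp add: slack_def[of ell V])
    qed
  qed
qed

text \<open>Optimal families for both ranks are merged: the one for \<open>l\<close> becomes a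
  partition, the one for \<open>ell\<close> is refined along it, and
  \<open>dense_family_bound\<close> applies to the result.\<close>

lemma rank_condition:
  assumes M: "M \<subseteq> E" "int (card M) \<le> l V + ell V" and K: "K \<subseteq> E - M"
  shows "slack l V + slack ell V \<le>
    int (card ((E - M) - K)) + max_card (sparse V N (slack l)) K + max_card (sparse V N (slack ell)) K"
proof -
  have KE: "K \<subseteq> E" using K by auto
  have fK: "finite K" "finite (E - M)" using KE finite_sub finite_E by auto
  obtain Q1 where Q1: "Q1 \<subseteq> Pow V" "pairwise (\<lambda>Y Z. card (Y \<inter> Z) < 1) Q1"
    "max_card (sparse V N (slack l)) K = int (card (uncovered N K Q1)) + (\<Sum>Y\<in>Q1. slack l Y)"
    by (rule max_card_sparse_formula[OF _ slack_intersecting_submodular[OF finite_V l_super] slack_l_nonneg KE])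
      (simp, assumption)
  obtain Q where Q: "Q \<subseteq> Pow V" "pairwise (\<lambda>Y Z. card (Y \<inter> Z) < 2) Q"
    "max_card (sparse V N (slack ell)) K = int (card (uncovered N K Q)) + (\<Sum>Y\<in>Q. slack ell Y)"
    by (rule max_card_sparse_formula[OF _ slack_intersecting_submodular[OF finite_V ell_super] slack_ell_nonneg KE])
      (simp, assumption)
  \<comment> \<open>Filling up with singletons makes \<open>Q1\<close> a partition; singletons and
    the empty set have slack 0 and contain no edge, so the rank formula is unchanged.\<close>
  define S where "S = (\<lambda>v. {v}) ` (V - \<Union>Q1)"
  define P where "P = (Q1 - {{}}) \<union> S"
  have fQ1: "finite Q1" using Q1 finite_family by simp
  have disQ1: "Y \<inter> Z = {}" if "Y \<in> Q1" "Z \<in> Q1" "Y \<noteq> Z" for Y Z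
  proof -
    have "finite (Y \<inter> Z)" using that Q1(1) finite_sub(2) by auto
    then show ?thesis using pairwiseD[OF Q1(2) that] by simp
  qed
  have P: "partition_on V P"
    unfolding partition_on_def
  proof (intro conjI)
    show "\<Union>P = V" using Q1(1) unfolding P_def S_def by auto
    show "disjoint P"
    proof (rule pairwiseI)
      fix X Y assume "X \<in> P" "Y \<in> P" "X \<noteq> Y"
      then show "disjnt X Y" using disQ1[of X Y] unfolding P_def S_def disjnt_def by auto
    qed
    show "{} \<notin> P" unfolding P_def S_def by auto
  qed
  have PV: "\<Union>P = V" and dis: "disjoint P" and fP: "finite P"
    using P finite_elements[OF finite_V P] unfolding partition_on_def by auto
  have uP: "uncovered N K P = uncovered N K Q1"
  proof -
    have "\<not> N e \<subseteq> {}" "\<not> N e \<subseteq> {v}" if "e \<in> K" for e v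
    proof -
      have "card (N e) = 2" using that KE ends(2) by auto
      then show "\<not> N e \<subseteq> {v}" using card_mono[of "{v}" "N e"] by auto
      show "\<not> N e \<subseteq> {}" using \<open>card (N e) = 2\<close> by auto
    qed
    then show ?thesis unfolding uncovered_def P_def S_def by blast
  qed
  have sP: "(\<Sum>X\<in>P. slack l X) = (\<Sum>X\<in>Q1. slack l X)"
  proof -
    have "(\<Sum>X\<in>P \<union> Q1. slack l X) = (\<Sum>X\<in>P. slack l X)"
      using fP fQ1 nonneg(3) by (intro sum.mono_neutral_right) (auto simp: P_def slack_def)
    moreover have "(\<Sum>X\<in>P \<union> Q1. slack l X) = (\<Sum>X\<in>Q1. slack l X)"
      using fP fQ1 by (intro sum.mono_neutral_right) (auto simp: P_def S_def slack_def)
    ultimately show ?thesis by simp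
  qed
  have sl: "(\<Sum>X\<in>P. slack l X) = (\<Sum>v\<in>V. l {v}) - (\<Sum>X\<in>P. l X)"
    unfolding slack_def sum_subtractf sum_partition[OF P] ..
  obtain R where R: "R \<subseteq> Pow V" "pairwise (\<lambda>Y Z. card (Y \<inter> Z) < 2) R" "\<And>Z. Z \<in> R \<Longrightarrow> dense Z"
    "\<And>Z. Z \<in> R \<Longrightarrow> \<exists>X\<in>P. Z \<subseteq> X"
    and Rle: "int (card (uncovered N (E - M) R)) + (\<Sum>Z\<in>R. slack ell Z) \<le>
     int (card (uncovered N (E - M) P \<union> uncovered N (E - M) Q)) + (\<Sum>Y\<in>Q. slack ell Y)"
    using refine_to_dense[OF P Q(1,2), of "E - M"] Diff_subset[of E M] by metis
  \<comment> \<open>Edges of \<open>E - M\<close> outside \<open>K\<close> are charged to the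
    complement term, the others to one of the two ranks.\<close>
  have "card (uncovered N (E - M) P \<union> uncovered N (E - M) Q) \<le>
      card ((E - M - K) \<union> (uncovered N K P \<union> uncovered N K Q))"
    using fK by (intro card_mono) (auto simp: uncovered_def)
  also have "\<dots> \<le> card (E - M - K) + (card (uncovered N K P) + card (uncovered N K Q))"
    using card_Un_le[of "E - M - K" "uncovered N K P \<union> uncovered N K Q"]
      card_Un_le[of "uncovered N K P" "uncovered N K Q"] by linarith
  finally have "card (uncovered N (E - M) P \<union> uncovered N (E - M) Q) \<le>
      card (E - M - K) + (card (uncovered N K P) + card (uncovered N K Q))" .
  moreover have "(\<Sum>X\<in>P. l X) - l V + slack ell V \<le>
      int (card (uncovered N (E - M) R)) + (\<Sum>Z\<in>R. slack ell Z)"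
    by (rule dense_family_bound[OF P R M])
  ultimately show ?thesis
    using Rle Q1(3) Q(3) sP sl unfolding slack_def[of l V] uP by linarith
qed

lemma disjoint_sparse_bases:
  assumes M: "M \<subseteq> E" "int (card M) \<le> l V + ell V"
  obtains I1 I2 where "I1 \<subseteq> E - M" "I2 \<subseteq> E - M" "I1 \<inter> I2 = {}"
    "sparse V N (slack l) I1" "sparse V N (slack ell) I2"
    "int (card I1) = slack l V" "int (card I2) = slack ell V"
proof -
  have sub: "E - M \<subseteq> E" by auto
  have "matroid_rank E (max_card (sparse V N (slack l)))"
    by (rule matroid_rank_sparse[OF _ slack_intersecting_submodular[OF finite_V l_super] slack_l_nonneg]) simp_all
  then have r1: "matroid_rank (E - M) (max_card (sparse V N (slack l)))" using sub by (rule matroid_rank_subset)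
  have "matroid_rank E (max_card (sparse V N (slack ell)))"
    by (rule matroid_rank_sparse[OF _ slack_intersecting_submodular[OF finite_V ell_super] slack_ell_nonneg]) simp_all
  then have r2: "matroid_rank (E - M) (max_card (sparse V N (slack ell)))" using sub by (rule matroid_rank_subset)
  obtain I1 I2 where I: "I1 \<subseteq> E - M" "I2 \<subseteq> E - M" "I1 \<inter> I2 = {}"
    "max_card (sparse V N (slack l)) I1 = int (card I1)" "max_card (sparse V N (slack ell)) I2 = int (card I2)"
    "slack l V + slack ell V \<le> int (card I1) + int (card I2)"
    using matroid_union_two[OF finite_sub(1)[OF sub] r1 r2 rank_condition[OF M]] by metis
  have fI: "finite I1" "finite I2" using I(1,2) sub by (auto intro!: finite_sub(1))
  have s1: "sparse V N (slack l) I1"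
    using I(4) max_card_indep_iff[of I1 "sparse V N (slack l)", OF fI(1) sparse_empty[OF slack_l_nonneg]] by simp
  have s2: "sparse V N (slack ell) I2"
    using I(5) max_card_indep_iff[of I2 "sparse V N (slack ell)", OF fI(2) sparse_empty[OF slack_ell_nonneg]] by simp
  \<comment> \<open>Sparsity at \<open>V\<close> bounds each size by its slack. As the sizes
    together reach the sum of the slacks, both bounds are equalities.\<close>
  have "edges_in N I1 V = I1" "edges_in N I2 V = I2" using I(1,2) ends(1) unfolding edges_in_def by auto
  then have "int (card I1) \<le> slack l V" "int (card I2) \<le> slack ell V"
    using s1 s2 unfolding sparse_def by (metis order_refl)+
  then show ?thesis using that[OF I(1-3) s1 s2] I(6) by linarith
qed

end

section \<open>The decomposition\<close>

theorem theorem6p1: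
  fixes G :: "('v, 'e) multigraph"
    and l ell :: "'v set \<Rightarrow> int"
    and M :: "'e set"
  assumes "finite_multigraph G"
    and "nonnegative_set_function_on (mverts G) l"
    and "nonincreasing_on (mverts G) l"
    and "intersecting_supermodular_on 1 (mverts G) l"
    and "nonnegative_set_function_on (mverts G) ell"
    and "intersecting_supermodular_on 2 (mverts G) ell"
    and "subadditive_on (mverts G) ell"
    and "\<And>v. v \<in> mverts G \<Longrightarrow> int (vertex_degree G v) \<ge> 2 * ell {v} + 2 * l {v}"
    and "\<And>A B. A \<inter> B = {} \<Longrightarrow> A \<union> B \<subset> mverts G \<Longrightarrow>
           int (induced_edge_count G (A \<union> B)) > (\<Sum>v\<in>A \<union> B. ell {v}) - ell (A \<union> B) \<Longrightarrow>
           int (cut_degree (delete_verts G B) A) \<ge>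
             2 * ell (A \<union> B) - (\<Sum>v\<in>B. ell {v}) + (if A = {} then 0 else 2 * l (A \<union> B))"
    and "M \<subseteq> medges G"
    and "int (card M) \<le> l (mverts G) + ell (mverts G)"
  shows "\<exists>H1 H2. spanning_subgraph H1 G \<and> partition_connected l H1 \<and>
           spanning_subgraph H2 G \<and> rigid ell H2 \<and>
           medges G = M \<union> medges H1 \<union> medges H2 \<and>
           M \<inter> medges H1 = {} \<and> M \<inter> medges H2 = {} \<and> medges H1 \<inter> medges H2 = {}"
proof -
  interpret packing_hypotheses "mverts G" "medges G" "mends G" l ell
  proof
    show "2 * ell {v} + 2 * l {v} \<le> int (degree_in (mends G) (medges G) v)" if "v \<in> mverts G" for v
      using assms(8)[OF that] unfolding vertex_degree_def degree_in_def .
    show "2 * ell (A \<union> B) - (\<Sum>v\<in>B. ell {v}) + (if A = {} then 0 else 2 * l (A \<union> B)) \<le>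
        int (card {e \<in> medges G. mends G e \<inter> B = {} \<and> card (mends G e \<inter> A) = 1})"
      if "A \<inter> B = {}" "A \<union> B \<subset> mverts G"
        "slack ell (A \<union> B) < int (card (edges_in (mends G) (medges G) (A \<union> B)))" for A B
      using assms(9)[OF that(1,2)] that(3)
      unfolding slack_def induced_edge_count_def edges_in_def cut_degree_def delete_verts_def
      by simp
  qed (use assms(1) in \<open>simp_all only: finite_multigraph_def assms(2-7)\<close>)
  obtain I1 I2 where I: "I1 \<subseteq> medges G - M" "I2 \<subseteq> medges G - M" "I1 \<inter> I2 = {}"
    and s: "sparse (mverts G) (mends G) (slack l) I1" "sparse (mverts G) (mends G) (slack ell) I2"
    and c: "int (card I1) = slack l (mverts G)" "int (card I2) = slack ell (mverts G)"
    by (rule disjoint_sparse_bases[OF assms(10,11)])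
  have IE: "I1 \<subseteq> medges G" "I2 \<subseteq> medges G" using I by auto
  define H1 where "H1 = G\<lparr>medges := I1\<rparr>"
  \<comment> \<open>All leftover edges go to \<open>H2\<close>, which stays rigid because rigidity
    only asks for the spanning subgraph \<open>F\<close> with edge set \<open>I2\<close>.\<close>
  define H2 where "H2 = G\<lparr>medges := medges G - M - I1\<rparr>"
  define F where "F = G\<lparr>medges := I2\<rparr>"
  have "partition_connected l H1"
    unfolding partition_connected_def
  proof (intro allI impI)
    fix P assume "partition_on (mverts H1) P"
    then have P: "partition_on (mverts G) P" unfolding H1_def by simp
    have PV: "\<Union>P = mverts G" using P unfolding partition_on_def by simp
    \<comment> \<open>An edge inside no part has an end in some part \<open>X\<close> and another
      end outside \<open>X\<close>, which lies in a different part.\<close>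
    have "uncovered (mends G) I1 P \<subseteq> {e \<in> medges H1. \<exists>X\<in>P. \<exists>Y\<in>P. X \<noteq> Y \<and> mends H1 e \<inter> X \<noteq> {} \<and> mends H1 e \<inter> Y \<noteq> {}}"
    proof
      fix e assume e: "e \<in> uncovered (mends G) I1 P"
      then have eI: "e \<in> I1" and eG: "e \<in> medges G" using IE unfolding uncovered_def by auto
      have "mends G e \<noteq> {}" using ends(2)[OF eG] by auto
      then obtain u X where u: "u \<in> mends G e" "u \<in> X" "X \<in> P" using ends(1)[OF eG] PV by blast
      then obtain w where w: "w \<in> mends G e" "w \<notin> X" using e unfolding uncovered_def by auto
      then obtain Y where Y: "w \<in> Y" "Y \<in> P" using ends(1)[OF eG] PV by blast
      have "X \<noteq> Y" "mends G e \<inter> X \<noteq> {}" "mends G e \<inter> Y \<noteq> {}" using u w Y by auto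
      then show "e \<in> {e \<in> medges H1. \<exists>X\<in>P. \<exists>Y\<in>P. X \<noteq> Y \<and> mends H1 e \<inter> X \<noteq> {} \<and> mends H1 e \<inter> Y \<noteq> {}}"
        using u(3) Y(2) eI unfolding H1_def by auto
    qed
    then have "card (uncovered (mends G) I1 P) \<le> cross_edge_count H1 P"
      unfolding cross_edge_count_def using finite_sub(1)[OF IE(1)] by (intro card_mono) (auto simp: H1_def)
    then show "(\<Sum>X\<in>P. l X) - l (mverts H1) \<le> int (cross_edge_count H1 P)"
      using sparse_base_cross_edges[OF IE(1) s(1) c(1) P] unfolding H1_def by simp
  qed
  moreover have "rigid ell H2"
    unfolding rigid_def
  proof (intro exI[of _ F] conjI allI impI)
    show "spanning_subgraph F H2" using I unfolding spanning_subgraph_def F_def H2_def by auto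
    show "int (card (medges F)) = (\<Sum>v\<in>mverts H2. ell {v}) - ell (mverts H2)"
      using c(2) unfolding F_def H2_def slack_def by simp
    show "int (induced_edge_count F X) \<le> (\<Sum>v\<in>X. ell {v}) - ell X" if "X \<subseteq> mverts H2" for X
      using s(2) that unfolding sparse_def slack_def edges_in_def induced_edge_count_def F_def H2_def by simp
  qed
  moreover have "spanning_subgraph H1 G" "spanning_subgraph H2 G"
    using IE unfolding spanning_subgraph_def H1_def H2_def by auto
  moreover have "medges G = M \<union> medges H1 \<union> medges H2" "M \<inter> medges H1 = {}" "M \<inter> medges H2 = {}"
    "medges H1 \<inter> medges H2 = {}"
    using I assms(10) unfolding H1_def H2_def by auto
  ultimately show ?thesis by (intro exI[of _ H1] exI[of _ H2] conjI)
qed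

end
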